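(* Let $\nu>0$ be given and let $\chi_\nu(x)=\frac{\Gamma(\frac{\nu+1}{2})}{\sqrt{\nu\pi}\,\Gamma(\frac\nu2)}\Big(1+\frac{x^2}{\nu}\Big)^{-(\nu+1)/2}$, $x\in\mathbb{R}$, be the $t$-density with $\nu$ degrees of freedom. Let $\Pi^*$ be a Type I or Type II location-scale mixture prior with kernel $\frac1\phi\chi_\nu\big(\frac{x-\theta}{\phi}\big)$, as defined in the context, satisfying the full support condition (B8) stated there. Let $f_0$ be a continuous density on $\mathbb{R}$ such that (B4) for some $0<M<\infty$, $0<f_0(x)\le M$ for all $x$; (B5) $\left|\int f_0(x)\log f_0(x)\,dx\right|<\infty$; (B6) for some $\delta>0$, $\int f_0(x)\log\frac{f_0(x)}{\phi_\delta(x)}\,dx<\infty$, where $\phi_\delta(x)=\inf_{|t-x|<\delta}f_0(t)$; and $\int_{\mathbb{R}}\log_+|x|\,f_0(x)\,dx<\infty$, where $\log_+u=\max(\log u,0)$. Then $f_0\in\mathrm{KL}(\Pi^* )$.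
   Context: $\mathscr{M}(S)$ is the set of probability measures on $S$, $\mathbb{R}^+=(0,\infty)$; a prior is a probability measure on the indicated space; the weak support of a prior on $\mathscr{M}(S)$ is its support in the topology of weak convergence. For a density $\chi$ on $\mathbb{R}$: a Type I location-scale mixture prior $\Pi^*$ is the law of $f_P(x)=\int\frac1\phi\chi\big(\frac{x-\theta}{\phi}\big)dP(\theta,\phi)$ with $P\sim\Pi$, $\Pi$ a prior on $\mathscr{M}(\mathbb{R}\times\mathbb{R}^+)$; condition (B8): the weak support of $\Pi$ is $\mathscr{M}(\mathbb{R}\times\mathbb{R}^+)$. A Type II location-scale mixture prior $\Pi^*$ is the law of $f_{P,\phi}(x)=\int\frac1\phi\chi\big(\frac{x-\theta}{\phi}\big)dP(\theta)$ with independent $P\sim\Pi$ and $\phi\sim\mu$, $\Pi$ a prior on $\mathscr{M}(\mathbb{R})$ and $\mu$ a prior on $(0,\infty)$; condition (B8) then means: the weak support of $\Pi$ is $\mathscr{M}(\mathbb{R})$ and the support of $\mu$ is $(0,\infty)$. $f_0\in\mathrm{KL}(\Pi^* )$ means $\Pi^*(\{f:\int f_0\log(f_0/f)<\epsilon\})>0$ for every $\epsilon>0$. *)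

theory Defs
  imports "HOL-Probability.Probability"
begin

definition prob_measures :: "'a::topological_space set \<Rightarrow> 'a measure set" where
  "prob_measures S = {P. prob_space P \<and> sets P = sets (restrict_space borel S)}"

definition weak_topology :: "'a::topological_space set \<Rightarrow> 'a measure topology" where
  "weak_topology S = topology_generated_by
     {{P \<in> prob_measures S. (\<integral>s. g s \<partial>P) \<in> V} | g V.
        continuous_on S g \<and> bounded (g ` S) \<and> open (V :: real set)}"

lemma topspace_weak_topology [simp]: "topspace (weak_topology S) = prob_measures S"
proof -
  have "prob_measures S \<in> {{P \<in> prob_measures S. (\<integral>s. g s \<partial>P) \<in> V} | g V.
        continuous_on S g \<and> bounded (g ` S) \<and> open (V :: real set)}"
    by (rule CollectI, rule exI[of _ "\<lambda>_. 0"], rule exI[of _ UNIV]) (auto simp: bounded_iff)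
  then show ?thesis
    unfolding weak_topology_def topology_generated_by_topspace by blast
qed

text \<open>Priors on the space of probability measures are Borel for the weak topology.\<close>

definition prior_on_measures :: "'a::topological_space set \<Rightarrow> 'a measure measure \<Rightarrow> bool" where
  "prior_on_measures S Q \<longleftrightarrow> prob_space Q \<and>
     sets Q = sets (sigma (prob_measures S) {U. openin (weak_topology S) U})"

definition support_in :: "'a topology \<Rightarrow> 'a measure \<Rightarrow> 'a set" where
  "support_in T M = {x \<in> topspace T. \<forall>U. openin T U \<and> x \<in> U \<longrightarrow> emeasure M U > 0}"

text \<open>
  The law of \<open>X\<close> under \<open>M\<close>, carried by the largest \<sigma>-algebra for which \<open>X\<close> is measurable.
  This avoids choosing a \<sigma>-algebra on the space of densities: with any other choice
  making \<open>X\<close> measurable, the law is a restriction of this one.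
\<close>

definition law :: "'a measure \<Rightarrow> ('a \<Rightarrow> 'b) \<Rightarrow> 'b measure" where
  "law M X = distr M (sigma UNIV {A. X -` A \<inter> space M \<in> sets M}) X"

lemma emeasure_law:
  assumes "X -` A \<inter> space M \<in> sets M"
  shows "emeasure (law M X) A = emeasure M (X -` A \<inter> space M)"
proof -
  let ?A = "{A. X -` A \<inter> space M \<in> sets M}"
  have "X \<in> measurable M (sigma UNIV ?A)"
    by (rule measurable_sigma_sets[where A = ?A and \<Omega> = UNIV]) auto
  moreover have "A \<in> sets (sigma UNIV ?A)"
    using assms by auto
  ultimately show ?thesis
    unfolding law_def by (rule emeasure_distr)
qed

text \<open>
  For type I mixtures the integral may be infinite, hence equal to 0 by convention, at some
  \<open>x\<close>; by Fubini's theorem these \<open>x\<close> form a Lebesgue null set.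
\<close>

definition mixture_density_I ::
    "(real \<Rightarrow> real) \<Rightarrow> (real \<times> real) measure \<Rightarrow> real \<Rightarrow> real" where
  "mixture_density_I k P x = (\<integral>z. (case z of (\<theta>, \<phi>) \<Rightarrow> 1 / \<phi> * k ((x - \<theta>) / \<phi>)) \<partial>P)"

definition mixture_density_II ::
    "(real \<Rightarrow> real) \<Rightarrow> real measure \<Rightarrow> real \<Rightarrow> real \<Rightarrow> real" where
  "mixture_density_II k P \<phi> x = (\<integral>\<theta>. 1 / \<phi> * k ((x - \<theta>) / \<phi>) \<partial>P)"

definition mixture_prior_I ::
    "(real \<Rightarrow> real) \<Rightarrow> (real \<times> real) measure measure \<Rightarrow> (real \<Rightarrow> real) measure" where
  "mixture_prior_I k Q = law Q (mixture_density_I k)"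

definition mixture_prior_II ::
    "(real \<Rightarrow> real) \<Rightarrow> real measure measure \<Rightarrow> real measure \<Rightarrow> (real \<Rightarrow> real) measure" where
  "mixture_prior_II k Q \<mu> = law (Q \<Otimes>\<^sub>M \<mu>) (\<lambda>(P, \<phi>). mixture_density_II k P \<phi>)"

definition full_support_I :: "(real \<times> real) measure measure \<Rightarrow> bool" where
  "full_support_I Q \<longleftrightarrow>
     support_in (weak_topology (UNIV \<times> {0<..})) Q = prob_measures (UNIV \<times> {0<..})"

definition full_support_II :: "real measure measure \<Rightarrow> real measure \<Rightarrow> bool" where
  "full_support_II Q \<mu> \<longleftrightarrow>
     support_in (weak_topology UNIV) Q = prob_measures UNIV \<and>
     support_in (top_of_set {0<..}) \<mu> = {0<..}"

definition is_density :: "(real \<Rightarrow> real) \<Rightarrow> bool" where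
  "is_density f \<longleftrightarrow> (\<forall>x. 0 \<le> f x) \<and> has_bochner_integral lborel f 1"

text \<open>
  \<open>KL_div f0 f\<close> is \<open>\<integral> f0 log (f0 / f)\<close> as an extended real. For densities the negative part
  of the integrand is integrable, so the integral is infinite precisely when \<open>f\<close> vanishes on
  a non-null subset of \<open>{f0 > 0}\<close> or the integrand is not integrable. Both cases have to be
  singled out because \<open>ln (a / 0) = 0\<close> and a divergent Bochner integral is 0.
\<close>

definition KL_div :: "(real \<Rightarrow> real) \<Rightarrow> (real \<Rightarrow> real) \<Rightarrow> ereal" where
  "KL_div f0 f =
     (if (AE x in lborel. f0 x > 0 \<longrightarrow> f x > 0) \<and>
         integrable lborel (\<lambda>x. f0 x * ln (f0 x / f x))
      then ereal (\<integral>x. f0 x * ln (f0 x / f x) \<partial>lborel) else \<infinity>)"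

definition in_KL_support :: "(real \<Rightarrow> real) \<Rightarrow> (real \<Rightarrow> real) measure \<Rightarrow> bool" where
  "in_KL_support f0 Q \<longleftrightarrow>
     (\<forall>\<epsilon>>0. emeasure Q {f. is_density f \<and> KL_div f0 f < ereal \<epsilon>} > 0)"

definition student_t_density :: "real \<Rightarrow> real \<Rightarrow> real" where
  "student_t_density \<nu> x =
     Gamma ((\<nu> + 1) / 2) / (sqrt (\<nu> * pi) * Gamma (\<nu> / 2)) *
     (1 + x\<^sup>2 / \<nu>) powr (- (\<nu> + 1) / 2)"

definition local_inf :: "real \<Rightarrow> (real \<Rightarrow> real) \<Rightarrow> real \<Rightarrow> real" where
  "local_inf \<delta> f x = (INF t\<in>{t. \<bar>t - x\<bar> < \<delta>}. f t)"

definition log_plus :: "real \<Rightarrow> real" where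
  "log_plus u = max (ln u) 0"

end

theory Submission
  imports Defs
begin

text \<open>
  The heavy tails of the \<open>t\<close>-kernel enter through a Harnack inequality: its values at two points
  \<open>x\<close> and \<open>y\<close> differ by at most the factor \<open>(1 + \<bar>x - y\<bar> / b) powr (\<nu> + 1)\<close>, where \<open>b\<close> is a
  multiple of the scale (\<open>student_t_density_Harnack\<close>). This inequality passes to mixtures whose scales
  are bounded away from \<open>0\<close>; in Type I mixtures the small scales are removed by a cutoff, which only
  makes the mixture smaller and so does not affect an upper bound on the divergence.

  Let \<open>F\<close> be the smoothing of \<open>f0\<close> by the kernel at scale \<open>h\<close>, that is, the mixture whose mixing
  measure \<open>P0\<close> has density \<open>f0\<close> in the location and is concentrated at \<open>h\<close> in the scale. By dominated
  convergence the divergence of \<open>F\<close> from \<open>f0\<close> tends to \<open>0\<close> with \<open>h\<close>; boundedness, finite entropy and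
  the condition on local infima provide the dominating function (\<open>KL_smoothing_small\<close>).

  Fix \<open>h\<close>. Prescribing lower bounds for the mixture at finitely many points defines a weakly open set
  around \<open>P0\<close>. By the Harnack inequality, a finite net of \<open>{-R..R}\<close> controls the mixture on the whole
  interval, and the single point \<open>0\<close> controls it on the whole line up to a factor of polynomial growth
  (\<open>weak_nbhd_kernel_integral\<close>). The logarithm of that factor is integrable against \<open>f0\<close> by the
  logarithmic moment condition, so the part \<open>\<bar>x\<bar> > R\<close> contributes little once \<open>R\<close> is large
  (\<open>KL_div_less_of_ratio_bound\<close>). Thus a whole neighbourhood of \<open>P0\<close> lies in the Kullback-Leibler
  ball, and full support gives it positive prior mass. In Type II mixtures the scale is allowed to vary in
  a short interval above \<open>h\<close>.

  The Kullback-Leibler ball must also be measurable for the law of the random density. This follows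
  from the measurability of evaluation \<open>P \<mapsto> P A\<close> for the weak topology
  (\<open>measurable_prior_subprob_algebra\<close>) and the fact that every mixture is an almost everywhere positive
  density (\<open>emeasure_law_KL_ball_pos\<close>, \<open>mixture_density\<close>).
\<close>

section \<open>The Student t-density\<close>

lemma student_t_density_pos: "\<nu> > 0 \<Longrightarrow> student_t_density \<nu> x > 0"
  unfolding student_t_density_def
  by (intro mult_pos_pos divide_pos_pos Gamma_real_pos) (auto simp: add_nonneg_eq_0_iff intro!: add_pos_nonneg)

lemma continuous_on_student_t_density [continuous_intros]:
  assumes "\<nu> > 0" "continuous_on A g"
  shows "continuous_on A (\<lambda>x. student_t_density \<nu> (g x))"
proof -
  have "1 + (g x)\<^sup>2 / \<nu> > 0" for x
    using assms(1) by (intro add_pos_nonneg) auto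
  then show ?thesis
    unfolding student_t_density_def using assms by (intro continuous_intros) (auto simp: less_imp_neq[symmetric])
qed

lemma measurable_student_t_density [measurable]: "student_t_density \<nu> \<in> borel_measurable borel"
  unfolding student_t_density_def by measurable

lemma student_t_density_antimono:
  assumes "\<nu> > 0" "\<bar>u\<bar> \<le> \<bar>v\<bar>" shows "student_t_density \<nu> v \<le> student_t_density \<nu> u"
proof -
  have "1 + u\<^sup>2 / \<nu> \<le> 1 + v\<^sup>2 / \<nu>"
    using assms by (auto intro!: divide_right_mono simp: abs_le_square_iff)
  then have "(1 + v\<^sup>2 / \<nu>) powr (- (\<nu> + 1) / 2) \<le> (1 + u\<^sup>2 / \<nu>) powr (- (\<nu> + 1) / 2)"
    using assms by (intro powr_mono2') (auto intro!: add_pos_nonneg)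
  moreover have "0 \<le> Gamma ((\<nu> + 1) / 2) / (sqrt (\<nu> * pi) * Gamma (\<nu> / 2))"
    using assms by (intro divide_nonneg_nonneg mult_nonneg_nonneg) auto
  ultimately show ?thesis
    unfolding student_t_density_def
    by (rule mult_left_mono)
qed

text \<open>
  A Harnack inequality: the values of the t-density at two points differ by at most a polynomial
  factor in their distance. The argument rests on this feature of the \<open>t\<close>-kernel, and it is where heavy
  tails matter; a Gaussian has no such bound. With
  \<open>a = \<bar>u\<bar> / sqrt \<nu>\<close> and \<open>t = \<bar>u - v\<bar> / sqrt \<nu>\<close> it comes from
  \<open>1 + (a + t)\<^sup>2 \<le> (1 + a\<^sup>2) (1 + t)\<^sup>2\<close>, which holds because \<open>2 a \<le> 1 + a\<^sup>2\<close>.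
\<close>

lemma student_t_density_Harnack:
  assumes "\<nu> > 0"
  shows "student_t_density \<nu> u \<le> (1 + \<bar>u - v\<bar> / sqrt \<nu>) powr (\<nu> + 1) * student_t_density \<nu> v"
proof -
  define a t where "a = \<bar>u\<bar> / sqrt \<nu>" and "t = \<bar>u - v\<bar> / sqrt \<nu>"
  have nn: "a \<ge> 0" "t \<ge> 0" using assms by (auto simp: a_def t_def)
  have a2: "u\<^sup>2 / \<nu> = a\<^sup>2" using assms by (simp add: a_def power_divide)
  have "v\<^sup>2 / \<nu> = (\<bar>v\<bar> / sqrt \<nu>)\<^sup>2" using assms by (simp add: power_divide)
  also have "\<dots> \<le> (a + t)\<^sup>2"
  proof (rule power_mono)
    have "\<bar>v\<bar> \<le> \<bar>u\<bar> + \<bar>u - v\<bar>" by linarith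
    then show "\<bar>v\<bar> / sqrt \<nu> \<le> a + t"
      unfolding a_def t_def add_divide_distrib[symmetric] using assms by (intro divide_right_mono) auto
  qed (use assms in auto)
  also have "1 + (a + t)\<^sup>2 \<le> (1 + a\<^sup>2) * (1 + t)\<^sup>2"
  proof -
    have "2 * a \<le> 1 + a\<^sup>2" using zero_le_power2[of "a - 1"] by (simp add: power2_eq_square algebra_simps)
    then have "2 * a * t \<le> (1 + a\<^sup>2) * t" using nn by (intro mult_right_mono) auto
    moreover have "0 \<le> (1 + a\<^sup>2) * t" "0 \<le> a\<^sup>2 * t\<^sup>2" using nn by auto
    ultimately show ?thesis by (simp add: power2_eq_square algebra_simps)
  qed
  finally have *: "1 + v\<^sup>2 / \<nu> \<le> (1 + u\<^sup>2 / \<nu>) * (1 + t)\<^sup>2" by (simp add: a2)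
  define e where "e = (\<nu> + 1) / 2"
  have pos: "1 + u\<^sup>2 / \<nu> > 0" "1 + v\<^sup>2 / \<nu> > 0" using assms by (auto intro!: add_pos_nonneg)
  have "(1 + v\<^sup>2 / \<nu>) powr e \<le> ((1 + u\<^sup>2 / \<nu>) * (1 + t)\<^sup>2) powr e"
    using * assms by (intro powr_mono2) (auto simp: e_def)
  also have "\<dots> = (1 + u\<^sup>2 / \<nu>) powr e * (1 + t) powr (\<nu> + 1)"
  proof -
    have "((1 + t)\<^sup>2) powr e = (1 + t) powr (\<nu> + 1)"
    proof -
      have "(1 + t)\<^sup>2 = (1 + t) powr 2" using nn by simp
      moreover have "2 * e = \<nu> + 1" by (simp add: e_def)
      ultimately show ?thesis by (simp only: powr_powr)
    qed
    then show ?thesis using nn pos by (simp add: powr_mult)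
  qed
  finally have "(1 + u\<^sup>2 / \<nu>) powr (- e) \<le> (1 + t) powr (\<nu> + 1) * (1 + v\<^sup>2 / \<nu>) powr (- e)"
    using pos by (simp add: powr_minus field_simps)
  moreover have "0 \<le> Gamma ((\<nu> + 1) / 2) / (sqrt (\<nu> * pi) * Gamma (\<nu> / 2))"
    using assms by (intro divide_nonneg_nonneg mult_nonneg_nonneg) auto
  ultimately have "Gamma ((\<nu> + 1) / 2) / (sqrt (\<nu> * pi) * Gamma (\<nu> / 2)) * (1 + u\<^sup>2 / \<nu>) powr (- e)
    \<le> Gamma ((\<nu> + 1) / 2) / (sqrt (\<nu> * pi) * Gamma (\<nu> / 2)) * ((1 + t) powr (\<nu> + 1) * (1 + v\<^sup>2 / \<nu>) powr (- e))"
    by (rule mult_left_mono)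
  moreover have "- (\<nu> + 1) / 2 = - e" by (simp only: e_def minus_divide_left)
  ultimately show ?thesis
    unfolding student_t_density_def t_def[symmetric] by (simp only: mult.left_commute)
qed

lemma nn_integral_powr_exp:
  assumes a: "a > 0" and c: "c > (0::real)"
  shows "(\<integral>\<^sup>+t. ennreal (indicator {0..} t * t powr (a - 1) * exp (- c * t)) \<partial>lborel) = ennreal (Gamma a / c powr a)"
proof -
  have "ennreal (Gamma a) = (\<integral>\<^sup>+t. ennreal (indicator {0..} t * t powr (a - 1) / exp t) \<partial>lborel)"
    by (rule Gamma_conv_nn_integral_real[OF a])
  also have "\<dots> = \<bar>c\<bar> * (\<integral>\<^sup>+t. ennreal (indicator {0..} (0 + c * t) * (0 + c * t) powr (a - 1) / exp (0 + c * t)) \<partial>lborel)"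
    using c by (subst nn_integral_real_affine[where c = c and t = 0]) auto
  also have "(\<integral>\<^sup>+t. ennreal (indicator {0..} (0 + c * t) * (0 + c * t) powr (a - 1) / exp (0 + c * t)) \<partial>lborel)
     = (\<integral>\<^sup>+t. ennreal (c powr (a - 1)) * ennreal (indicator {0..} t * t powr (a - 1) * exp (- c * t)) \<partial>lborel)"
    using c by (intro nn_integral_cong)
      (auto simp: indicator_def zero_le_mult_iff powr_mult exp_minus field_simps simp flip: ennreal_mult)
  also have "\<dots> = ennreal (c powr (a - 1)) * (\<integral>\<^sup>+t. ennreal (indicator {0..} t * t powr (a - 1) * exp (- c * t)) \<partial>lborel)"
    by (rule nn_integral_cmult) measurable
  finally have "ennreal (Gamma a) = ennreal (c powr a) * (\<integral>\<^sup>+t. ennreal (indicator {0..} t * t powr (a - 1) * exp (- c * t)) \<partial>lborel)"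
    using c by (simp add: powr_diff ennreal_mult'[symmetric] mult.assoc[symmetric])
  then have "ennreal (1 / c powr a) * ennreal (Gamma a) =
    ennreal (1 / c powr a) * ennreal (c powr a) * (\<integral>\<^sup>+t. ennreal (indicator {0..} t * t powr (a - 1) * exp (- c * t)) \<partial>lborel)"
    by (simp add: mult.assoc)
  then show ?thesis
    using c a by (simp add: ennreal_mult'[symmetric] Gamma_real_nonneg)
qed

lemma nn_integral_gaussian:
  assumes c: "c > (0::real)"
  shows "(\<integral>\<^sup>+x. ennreal (exp (- c * x\<^sup>2)) \<partial>lborel) = ennreal (sqrt (pi / c))"
proof -
  define \<sigma> where "\<sigma> = sqrt (1 / (2 * c))"
  have s: "\<sigma> > 0" "2 * \<sigma>\<^sup>2 = 1 / c" using c by (auto simp: \<sigma>_def)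
  have "exp (- c * x\<^sup>2) = sqrt (pi / c) * normal_density 0 \<sigma> x" for x
  proof -
    have *: "2 * pi * \<sigma>\<^sup>2 = pi / c" using s(2) by (simp add: field_simps)
    have "x\<^sup>2 / (2 * \<sigma>\<^sup>2) = c * x\<^sup>2" by (simp add: s(2))
    then show ?thesis using c unfolding normal_density_def * by simp
  qed
  then have "(\<integral>\<^sup>+x. ennreal (exp (- c * x\<^sup>2)) \<partial>lborel) = (\<integral>\<^sup>+x. ennreal (sqrt (pi / c)) * ennreal (normal_density 0 \<sigma> x) \<partial>lborel)"
    using c by (simp add: ennreal_mult')
  also have "\<dots> = ennreal (sqrt (pi / c)) * (\<integral>\<^sup>+x. ennreal (normal_density 0 \<sigma> x) \<partial>lborel)"
    by (rule nn_integral_cmult) measurable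
  also have "(\<integral>\<^sup>+x. ennreal (normal_density 0 \<sigma> x) \<partial>lborel) = 1"
    using s by (subst nn_integral_eq_integral) auto
  finally show ?thesis by simp
qed

text \<open>
  The t-density is a Gamma mixture of centred Gaussians: by the Gamma integral,
  \<open>\<Gamma>(a) (1 + x\<^sup>2 / \<nu>) powr (- a)\<close> is the integral of \<open>s powr (a - 1) * exp (- (1 + x\<^sup>2 / \<nu>) s)\<close>
  over \<open>s > 0\<close>, where \<open>a = (\<nu> + 1) / 2\<close>. Exchanging the integrals leaves a Gaussian integral
  in \<open>x\<close> followed by a Gamma integral in \<open>s\<close>.
\<close>

lemma nn_integral_student_t_density:
  assumes \<nu>: "\<nu> > 0"
  shows "(\<integral>\<^sup>+x. ennreal (student_t_density \<nu> x) \<partial>lborel) = 1"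
proof -
  define a where "a = (\<nu> + 1) / 2"
  define C where "C = 1 / (sqrt (\<nu> * pi) * Gamma (\<nu> / 2))"
  have a: "a > 0" using \<nu> by (simp add: a_def)
  have C: "C > 0" using \<nu> by (auto simp: C_def)
  have pos: "1 + x\<^sup>2 / \<nu> > 0" for x using \<nu> by (auto intro!: add_pos_nonneg)
  define F where "F x s = indicator {0..} s * s powr (a - 1) * exp (- (1 + x\<^sup>2 / \<nu>) * s)" for x s :: real
  have [measurable]: "(\<lambda>(x, s). F x s) \<in> borel_measurable (borel \<Otimes>\<^sub>M borel)"
    unfolding F_def by measurable
  have "(\<integral>\<^sup>+x. ennreal (student_t_density \<nu> x) \<partial>lborel) = (\<integral>\<^sup>+x. ennreal C * (\<integral>\<^sup>+s. ennreal (F x s) \<partial>lborel) \<partial>lborel)"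
    unfolding F_def nn_integral_powr_exp[OF a pos] using C
    by (intro nn_integral_cong)
      (simp add: ennreal_mult'[symmetric] student_t_density_def C_def a_def powr_minus_divide minus_divide_left[symmetric]
        del: minus_add_distrib)
  also have "\<dots> = ennreal C * (\<integral>\<^sup>+x. \<integral>\<^sup>+s. ennreal (F x s) \<partial>lborel \<partial>lborel)"
    by (rule nn_integral_cmult) measurable
  also have "(\<integral>\<^sup>+x. \<integral>\<^sup>+s. ennreal (F x s) \<partial>lborel \<partial>lborel) = (\<integral>\<^sup>+s. \<integral>\<^sup>+x. ennreal (F x s) \<partial>lborel \<partial>lborel)"
    by (rule lborel_pair.Fubini'[symmetric]) measurable
  also have "\<dots> = (\<integral>\<^sup>+s. ennreal (sqrt (\<nu> * pi)) * ennreal (indicator {0..} s * s powr (\<nu> / 2 - 1) * exp (- 1 * s)) \<partial>lborel)"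
  proof (rule nn_integral_cong_AE)
    have "AE s in lborel. s \<noteq> (0::real)" by (rule AE_lborel_singleton)
    then show "AE s in lborel. (\<integral>\<^sup>+x. ennreal (F x s) \<partial>lborel)
      = ennreal (sqrt (\<nu> * pi)) * ennreal (indicator {0..} s * s powr (\<nu> / 2 - 1) * exp (- 1 * s))"
    proof eventually_elim
      case (elim s)
      show ?case
      proof (cases "s > 0")
        case True
        have "(\<integral>\<^sup>+x. ennreal (F x s) \<partial>lborel)
          = (\<integral>\<^sup>+x. ennreal (s powr (a - 1) * exp (- s)) * ennreal (exp (- (s / \<nu>) * x\<^sup>2)) \<partial>lborel)"
          using True by (intro nn_integral_cong)
            (simp add: F_def ennreal_mult'[symmetric] exp_add[symmetric] algebra_simps)
        also have "\<dots> = ennreal (s powr (a - 1) * exp (- s)) * ennreal (sqrt (pi / (s / \<nu>)))"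
          using True \<nu> nn_integral_gaussian[of "s / \<nu>"] by (subst nn_integral_cmult) auto
        also have "sqrt (pi / (s / \<nu>)) = sqrt (\<nu> * pi) * s powr (- 1 / 2)"
          using True \<nu> by (simp add: real_sqrt_divide powr_minus powr_half_sqrt field_simps real_sqrt_mult)
        also have "ennreal (s powr (a - 1) * exp (- s)) * ennreal (sqrt (\<nu> * pi) * s powr (- 1 / 2))
          = ennreal (sqrt (\<nu> * pi)) * ennreal (indicator {0..} s * (s powr (a - 1) * s powr (- 1 / 2)) * exp (- 1 * s))"
          using True \<nu> by (simp add: ennreal_mult'[symmetric] mult_ac)
        also have "s powr (a - 1) * s powr (- 1 / 2) = s powr (\<nu> / 2 - 1)"
        proof -
          have "a - 1 + - 1 / 2 = \<nu> / 2 - 1" by (simp add: a_def field_simps)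
          then show ?thesis by (simp only: powr_add[symmetric])
        qed
        finally show ?thesis .
      qed (use elim in \<open>auto simp: F_def\<close>)
    qed
  qed
  also have "\<dots> = ennreal (sqrt (\<nu> * pi)) * ennreal (Gamma (\<nu> / 2) / 1 powr (\<nu> / 2))"
    using \<nu> by (subst nn_integral_cmult) (auto simp: nn_integral_powr_exp[where c = 1, simplified])
  also have "ennreal C * \<dots> = 1"
    using \<nu> Gamma_real_pos[of "\<nu> / 2", THEN less_imp_neq] by (auto simp: C_def ennreal_mult'[symmetric])
  finally show ?thesis .
qed

section \<open>The location-scale kernel\<close>

lemma student_t_is_density: "\<nu> > 0 \<Longrightarrow> is_density (student_t_density \<nu>)"
  unfolding is_density_def
  by (auto intro!: has_bochner_integral_nn_integral less_imp_le[OF student_t_density_pos]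
    simp: nn_integral_student_t_density)

definition t_kernel :: "real \<Rightarrow> real \<Rightarrow> real \<Rightarrow> real \<Rightarrow> real" where
  "t_kernel \<nu> x \<theta> \<phi> = 1 / \<phi> * student_t_density \<nu> ((x - \<theta>) / \<phi>)"

lemma measurable_t_kernel [measurable (raw)]:
  assumes "f \<in> borel_measurable M" "g \<in> borel_measurable M" "h \<in> borel_measurable M"
  shows "(\<lambda>p. t_kernel \<nu> (f p) (g p) (h p)) \<in> borel_measurable M"
  unfolding t_kernel_def using assms by measurable

lemma t_kernel_pos: "\<nu> > 0 \<Longrightarrow> \<phi> > 0 \<Longrightarrow> 0 < t_kernel \<nu> x \<theta> \<phi>"
  by (simp add: t_kernel_def student_t_density_pos)

lemma continuous_on_t_kernel [continuous_intros]:
  assumes "\<nu> > 0" "continuous_on A g" "continuous_on A h" "\<And>z. z \<in> A \<Longrightarrow> 0 < h z"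
  shows "continuous_on A (\<lambda>z. t_kernel \<nu> x (g z) (h z))"
  unfolding t_kernel_def using assms by (intro continuous_intros) (auto simp: less_imp_neq[symmetric])

lemma t_kernel_le:
  assumes "\<nu> > 0" "\<phi> > 0"
  shows "t_kernel \<nu> x \<theta> \<phi> \<le> student_t_density \<nu> 0 / \<phi>"
  using student_t_density_antimono[OF assms(1), of 0 "(x - \<theta>) / \<phi>"] assms
  by (simp add: t_kernel_def divide_right_mono)

lemma nn_integral_t_kernel:
  assumes "\<nu> > 0" "\<phi> > 0"
  shows "(\<integral>\<^sup>+x. ennreal (t_kernel \<nu> x \<theta> \<phi>) \<partial>lborel) = 1"
proof -
  have "(\<integral>\<^sup>+x. ennreal (t_kernel \<nu> x \<theta> \<phi>) \<partial>lborel)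
    = ennreal \<bar>\<phi>\<bar> * (\<integral>\<^sup>+u. ennreal (t_kernel \<nu> (\<theta> + \<phi> * u) \<theta> \<phi>) \<partial>lborel)"
    using assms by (intro nn_integral_real_affine) auto
  also have "\<dots> = (\<integral>\<^sup>+u. ennreal \<bar>\<phi>\<bar> * ennreal (t_kernel \<nu> (\<theta> + \<phi> * u) \<theta> \<phi>) \<partial>lborel)"
    by (rule nn_integral_cmult[symmetric]) measurable
  also have "\<dots> = (\<integral>\<^sup>+u. ennreal (student_t_density \<nu> u) \<partial>lborel)"
    using assms by (intro nn_integral_cong) (simp add: t_kernel_def ennreal_mult'[symmetric])
  finally show ?thesis using assms by (simp add: nn_integral_student_t_density)
qed

lemma t_kernel_Harnack:
  assumes \<nu>: "\<nu> > 0" and a: "0 < a" "a \<le> \<phi>"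
  shows "t_kernel \<nu> x \<theta> \<phi> \<le> (1 + \<bar>x - y\<bar> / (a * sqrt \<nu>)) powr (\<nu> + 1) * t_kernel \<nu> y \<theta> \<phi>"
proof -
  have "\<bar>(x - \<theta>) / \<phi> - (y - \<theta>) / \<phi>\<bar> / sqrt \<nu> = \<bar>x - y\<bar> / (\<phi> * sqrt \<nu>)"
    using a by (simp add: diff_divide_distrib[symmetric] abs_divide)
  also have "\<dots> \<le> \<bar>x - y\<bar> / (a * sqrt \<nu>)"
    using a \<nu> by (intro divide_left_mono mult_right_mono) auto
  finally have "(1 + \<bar>(x - \<theta>) / \<phi> - (y - \<theta>) / \<phi>\<bar> / sqrt \<nu>) powr (\<nu> + 1)
    \<le> (1 + \<bar>x - y\<bar> / (a * sqrt \<nu>)) powr (\<nu> + 1)"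
    using \<nu> by (intro powr_mono2) auto
  then have "student_t_density \<nu> ((x - \<theta>) / \<phi>)
    \<le> (1 + \<bar>x - y\<bar> / (a * sqrt \<nu>)) powr (\<nu> + 1) * student_t_density \<nu> ((y - \<theta>) / \<phi>)"
    using student_t_density_Harnack[OF \<nu>, of "(x - \<theta>) / \<phi>" "(y - \<theta>) / \<phi>"] student_t_density_pos[OF \<nu>]
    by (meson mult_right_mono less_imp_le order_trans)
  from divide_right_mono[OF this, of \<phi>] show ?thesis
    using a by (simp add: t_kernel_def)
qed

text \<open>
  Enlarging the scale of the kernel loses at most the ratio of the scales, since the t-density
  decreases away from \<open>0\<close>. In Type II mixtures this absorbs a random scale slightly above \<open>h\<close>.
\<close>

lemma t_kernel_scale:
  assumes "\<nu> > 0" "0 < h" "h \<le> \<phi>"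
  shows "t_kernel \<nu> x \<theta> h \<le> \<phi> / h * t_kernel \<nu> x \<theta> \<phi>"
proof -
  have "\<bar>(x - \<theta>) / \<phi>\<bar> \<le> \<bar>(x - \<theta>) / h\<bar>"
    using assms by (auto simp: abs_divide intro!: divide_left_mono)
  then have "student_t_density \<nu> ((x - \<theta>) / h) \<le> student_t_density \<nu> ((x - \<theta>) / \<phi>)"
    by (rule student_t_density_antimono[OF assms(1)])
  then show ?thesis using assms by (simp add: t_kernel_def divide_right_mono)
qed

lemma integral_t_kernel_density:
  assumes f0: "is_density f0" and h: "h > 0"
  shows "(\<integral>\<theta>. t_kernel \<nu> x \<theta> h \<partial>density lborel (\<lambda>\<theta>. ennreal (f0 \<theta>)))
    = (\<integral>u. student_t_density \<nu> u * f0 (x - h * u) \<partial>lborel)"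
proof -
  have [measurable]: "f0 \<in> borel_measurable borel"
    using f0 borel_measurable_integrable by (force simp: is_density_def has_bochner_integral_iff)
  have "(\<integral>\<theta>. t_kernel \<nu> x \<theta> h \<partial>density lborel (\<lambda>\<theta>. ennreal (f0 \<theta>))) = (\<integral>\<theta>. f0 \<theta> *\<^sub>R t_kernel \<nu> x \<theta> h \<partial>lborel)"
    using f0 by (intro integral_density) (auto simp: is_density_def)
  also have "\<dots> = \<bar>- h\<bar> *\<^sub>R (\<integral>u. f0 (x + - h * u) *\<^sub>R t_kernel \<nu> x (x + - h * u) h \<partial>lborel)"
    using h by (intro lborel_integral_real_affine) auto
  also have "\<dots> = (\<integral>u. h * (f0 (x + - h * u) * t_kernel \<nu> x (x + - h * u) h) \<partial>lborel)"
    using h by simp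
  also have "\<dots> = (\<integral>u. student_t_density \<nu> u * f0 (x - h * u) \<partial>lborel)"
    using h by (intro Bochner_Integration.integral_cong) (auto simp: t_kernel_def)
  finally show ?thesis .
qed

section \<open>Priors for the weak topology\<close>

lemma space_prior: "prior_on_measures S Q \<Longrightarrow> space Q = prob_measures S"
  unfolding prior_on_measures_def by (auto dest: sets_eq_imp_space_eq simp: space_measure_of_conv)

lemma openin_sets_prior: "prior_on_measures S Q \<Longrightarrow> openin (weak_topology S) U \<Longrightarrow> U \<in> sets Q"
  using openin_subset[of "weak_topology S"] unfolding prior_on_measures_def
  by (fastforce intro!: in_measure_of)

lemma prob_measuresD:
  assumes "P \<in> prob_measures S"
  shows "prob_space P" "sets P = sets (restrict_space borel S)" "space P = S"
  using assms sets_eq_imp_space_eq[of P "restrict_space borel S"]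
  by (auto simp: prob_measures_def space_restrict_space)

lemma openin_weak_topology_integral:
  fixes S :: "'a::topological_space set" and V :: "real set"
  assumes "continuous_on S g" "bounded (g ` S)" "open V"
  shows "openin (weak_topology S) {P \<in> prob_measures S. (\<integral>s. g s \<partial>P) \<in> V}"
  unfolding weak_topology_def using assms by (intro topology_generated_by_Basis) blast

lemma integrable_bounded_continuous:
  assumes P: "P \<in> prob_measures S" and g: "continuous_on S g" "bounded (g ` S)"
  shows "integrable P (g :: _ \<Rightarrow> real)"
proof -
  interpret prob_space P by (rule prob_measuresD[OF P])
  obtain B where "\<And>s. s \<in> S \<Longrightarrow> norm (g s) \<le> B"
    using g(2) by (auto simp: bounded_iff)
  moreover have "g \<in> borel_measurable P"
    using borel_measurable_continuous_on_restrict[OF g(1)]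
    by (simp add: measurable_cong_sets[OF prob_measuresD(2)[OF P] refl])
  ultimately show ?thesis
    by (intro integrable_const_bound[where B = B]) (auto simp: prob_measuresD(3)[OF P])
qed

lemma borel_measurable_integral_prior:
  fixes S :: "'a::topological_space set" and g :: "'a \<Rightarrow> real"
  assumes Q: "prior_on_measures S Q" and g: "continuous_on S g" "bounded (g ` S)"
  shows "(\<lambda>P. \<integral>s. g s \<partial>P) \<in> borel_measurable Q"
proof (rule borel_measurableI)
  fix V :: "real set" assume "open V"
  have "(\<lambda>P. \<integral>s. g s \<partial>P) -` V \<inter> space Q = {P \<in> prob_measures S. (\<integral>s. g s \<partial>P) \<in> V}"
    by (auto simp: space_prior[OF Q])
  then show "(\<lambda>P. \<integral>s. g s \<partial>P) -` V \<inter> space Q \<in> sets Q"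
    using openin_sets_prior[OF Q] openin_weak_topology_integral[OF g \<open>open V\<close>] by simp
qed

text \<open>
  The Borel \<sigma>-algebra of the weak topology makes \<open>P \<mapsto> P A\<close> measurable for every Borel set \<open>A\<close>:
  for closed \<open>A\<close> the indicator is a pointwise limit of bounded continuous functions of the distance
  to \<open>A\<close>, and closed sets generate. Hence mixing measures may be treated as points of
  the space of the Giry monad, on which integration is measurable in the measure.
\<close>

lemma measurable_prior_subprob_algebra:
  fixes S :: "'a::metric_space set"
  assumes Q: "prior_on_measures S Q" and S: "S \<in> sets borel"
  shows "(\<lambda>P. P) \<in> Q \<rightarrow>\<^sub>M subprob_algebra (restrict_space borel S)"
proof (rule measurable_subprob_algebra_generated)
  show "sets (restrict_space borel S) = sigma_sets S ((\<inter>) S ` Collect closed)"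
    using S by (simp add: sets_restrict_space borel_eq_closed sigma_sets_Int)
  show "Int_stable ((\<inter>) S ` Collect closed)"
  proof (rule Int_stableI)
    fix a b assume "a \<in> (\<inter>) S ` Collect closed" "b \<in> (\<inter>) S ` Collect closed"
    then obtain A B where "closed A" "closed B" "a = S \<inter> A" "b = S \<inter> B" by auto
    then show "a \<inter> b \<in> (\<inter>) S ` Collect closed" by (intro image_eqI[where x = "A \<inter> B"]) auto
  qed
  show "(\<inter>) S ` Collect closed \<subseteq> Pow S" by auto
  fix P assume "P \<in> space Q"
  then have P: "P \<in> prob_measures S" by (simp add: space_prior[OF Q])
  show "subprob_space P" by (intro prob_space_imp_subprob_space prob_measuresD[OF P])
  show "sets P = sets (restrict_space borel S)" by (rule prob_measuresD[OF P])
next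
  show "(\<lambda>P. emeasure P S) \<in> borel_measurable Q"
  proof (rule measurable_cong[THEN iffD2])
    fix P assume "P \<in> space Q"
    then have P: "P \<in> prob_measures S" by (simp add: space_prior[OF Q])
    show "emeasure P S = 1"
      using prob_space.emeasure_space_1[OF prob_measuresD(1)[OF P]] by (simp add: prob_measuresD[OF P])
  qed simp
next
  fix A assume "A \<in> (\<inter>) S ` Collect closed"
  then obtain C where A: "A = S \<inter> C" and C: "closed C" by auto
  show "(\<lambda>P. emeasure P A) \<in> borel_measurable Q"
  proof (cases "C = {}")
    case False
    define g where "g n x = max 0 (1 - real n * infdist x C)" for n x
    have g: "continuous_on S (g n)" "bounded (g n ` S)" for n
    proof -
      show "continuous_on S (g n)" unfolding g_def by (intro continuous_intros)
      show "bounded (g n ` S)"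
        unfolding bounded_iff g_def by (intro exI[of _ 1]) (auto simp: infdist_nonneg)
    qed
    have lim: "(\<lambda>n. g n x) \<longlonglongrightarrow> indicator C x" for x
    proof (cases "x \<in> C")
      case True then show ?thesis by (simp add: g_def)
    next
      case False
      then have d: "infdist x C > 0" using C \<open>C \<noteq> {}\<close> by (intro infdist_pos_not_in_closed)
      then obtain N where N: "1 < real N * infdist x C" using reals_Archimedean3 by blast
      have "\<forall>\<^sub>F n in sequentially. g n x = indicator C x"
        using eventually_ge_at_top[of N]
      proof eventually_elim
        case (elim n)
        then have "real N * infdist x C \<le> real n * infdist x C" using d by (intro mult_right_mono) auto
        then show ?case using N False by (simp add: g_def)
      qed
      then show ?thesis by (rule tendsto_eventually)
    qed
    have "(\<lambda>P. measure P A) \<in> borel_measurable Q"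
    proof (rule borel_measurable_LIMSEQ_real)
      show "(\<lambda>P. \<integral>x. g n x \<partial>P) \<in> borel_measurable Q" for n
        by (rule borel_measurable_integral_prior[OF Q g])
      fix P assume "P \<in> space Q"
      then have P: "P \<in> prob_measures S" by (simp add: space_prior[OF Q])
      interpret prob_space P by (rule prob_measuresD[OF P])
      have AP: "A \<in> sets P" using C by (auto simp: A prob_measuresD[OF P] sets_restrict_space)
      have "(\<lambda>n. \<integral>x. g n x \<partial>P) \<longlonglongrightarrow> (\<integral>x. indicator A x \<partial>P)"
      proof (rule integral_dominated_convergence[where w = "\<lambda>_. 1"])
        show "g n \<in> borel_measurable P" for n
          using integrable_bounded_continuous[OF P g] by (rule borel_measurable_integrable)
        show "AE x in P. (\<lambda>n. g n x) \<longlonglongrightarrow> indicator A x"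
          using lim by (intro AE_I2) (simp add: prob_measuresD[OF P] A indicator_def)
        show "AE x in P. norm (g n x) \<le> 1" for n
          by (auto simp: g_def infdist_nonneg)
      qed (use AP in auto)
      then show "(\<lambda>n. \<integral>x. g n x \<partial>P) \<longlonglongrightarrow> measure P A" using AP by simp
    qed
    then show ?thesis
    proof (rule measurable_cong[THEN iffD2, rotated, OF measurable_compose[OF _ measurable_ennreal]])
      fix P assume "P \<in> space Q"
      then have P: "P \<in> prob_measures S" by (simp add: space_prior[OF Q])
      interpret prob_space P by (rule prob_measuresD[OF P])
      show "emeasure P A = ennreal (measure P A)" by (rule emeasure_eq_measure)
    qed
  qed (simp add: A)
qed

section \<open>Measurability and positivity of mixtures\<close>

text \<open>
  A law gives mass \<open>0\<close> to every set outside its \<sigma>-algebra, so a Kullback-Leibler ball containing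
  the image of a set of positive measure has positive mass only if its preimage is measurable. For a
  jointly measurable family of densities that are positive almost everywhere, the case distinction
  in \<^const>\<open>KL_div\<close> reduces to integrability, and the preimage is described by two measurable
  parameter integrals.
\<close>

lemma emeasure_law_KL_ball_pos:
  assumes X [measurable]: "(\<lambda>(p, x). X p x) \<in> borel_measurable (M \<Otimes>\<^sub>M lborel)"
    and f0 [measurable]: "f0 \<in> borel_measurable borel"
    and dens: "\<And>p. p \<in> space M \<Longrightarrow> is_density (X p)"
    and pos: "\<And>p. p \<in> space M \<Longrightarrow> AE x in lborel. 0 < X p x"
    and U: "U \<in> sets M" "emeasure M U > 0"
    and KL: "\<And>p. p \<in> U \<Longrightarrow> KL_div f0 (X p) < ereal \<epsilon>"
  shows "emeasure (law M X) {f. is_density f \<and> KL_div f0 f < ereal \<epsilon>} > 0"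
proof -
  let ?A = "{f. is_density f \<and> KL_div f0 f < ereal \<epsilon>}"
  let ?h = "\<lambda>p x. f0 x * ln (f0 x / X p x)"
  have h [measurable]: "(\<lambda>(p, x). ?h p x) \<in> borel_measurable (M \<Otimes>\<^sub>M lborel)" by measurable
  have eq: "X -` ?A \<inter> space M
    = {p \<in> space M. (\<integral>\<^sup>+x. norm (?h p x) \<partial>lborel) < \<infinity> \<and> (\<integral>x. ?h p x \<partial>lborel) < \<epsilon>}"
  proof -
    have "p \<in> X -` ?A \<longleftrightarrow> (\<integral>\<^sup>+x. norm (?h p x) \<partial>lborel) < \<infinity> \<and> (\<integral>x. ?h p x \<partial>lborel) < \<epsilon>"
      if p: "p \<in> space M" for p
    proof -
      have "AE x in lborel. f0 x > 0 \<longrightarrow> X p x > 0" using pos[OF p] by eventually_elim simp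
      moreover have "?h p \<in> borel_measurable lborel"
        using measurable_compose[OF measurable_Pair1' h] p by simp
      ultimately show ?thesis
        using dens[OF p] unfolding vimage_eq mem_Collect_eq KL_div_def integrable_iff_bounded by auto
    qed
    then show ?thesis by blast
  qed
  have meas: "X -` ?A \<inter> space M \<in> sets M"
    unfolding eq by measurable
  have "U \<subseteq> X -` ?A \<inter> space M"
    using KL dens sets.sets_into_space[OF U(1)] by auto
  then have "emeasure M U \<le> emeasure M (X -` ?A \<inter> space M)"
    by (rule emeasure_mono) (rule meas)
  then show ?thesis
    using U(2) by (simp add: emeasure_law[OF meas] less_le_trans)
qed

locale density_kernel =
  fixes N :: "'a measure" and k :: "real \<Rightarrow> 'a \<Rightarrow> real"
  assumes measurable_kernel [measurable]: "(\<lambda>(x, z). k x z) \<in> borel_measurable (borel \<Otimes>\<^sub>M N)"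
    and kernel_pos: "z \<in> space N \<Longrightarrow> 0 < k x z"
    and kernel_mass: "z \<in> space N \<Longrightarrow> (\<integral>\<^sup>+x. ennreal (k x z) \<partial>lborel) = 1"
begin

text \<open>
  By Tonelli's theorem the mixture has total mass \<open>1\<close>; in particular the mixing integral is finite
  for almost every \<open>x\<close>. Elsewhere the Bochner integral is \<open>0\<close>, which is why positivity
  holds only almost everywhere.
\<close>

lemma mixture_density:
  assumes P: "prob_space P" and sets [measurable_cong]: "sets P = sets N"
  shows "is_density (\<lambda>x. \<integral>z. k x z \<partial>P)"
    and "AE x in lborel. integrable P (k x)"
    and "AE x in lborel. 0 < (\<integral>z. k x z \<partial>P)"
proof -
  interpret prob_space P by fact
  interpret pair_sigma_finite P lborel ..
  have space: "space P = space N" using sets by (rule sets_eq_imp_space_eq)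
  have km [measurable]: "k x \<in> borel_measurable P" for x
    using measurable_compose[OF measurable_Pair1' measurable_kernel, of x]
    by (simp cong: measurable_cong_sets add: sets)
  define G where "G x = (\<integral>\<^sup>+z. ennreal (k x z) \<partial>P)" for x
  have Gm [measurable]: "G \<in> borel_measurable lborel"
    unfolding G_def by measurable
  have "(\<integral>\<^sup>+x. G x \<partial>lborel) = (\<integral>\<^sup>+z. (\<integral>\<^sup>+x. ennreal (k x z) \<partial>lborel) \<partial>P)"
    unfolding G_def by (rule Fubini') measurable
  also have "\<dots> = (\<integral>\<^sup>+z. 1 \<partial>P)" by (intro nn_integral_cong) (simp add: kernel_mass space)
  also have "\<dots> = 1" by (simp add: emeasure_space_1)
  finally have G1: "(\<integral>\<^sup>+x. G x \<partial>lborel) = 1" .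
  then have fin: "AE x in lborel. G x \<noteq> \<infinity>"
    by (intro nn_integral_PInf_AE) auto
  have int_eq: "(\<integral>z. k x z \<partial>P) = enn2real (G x)" for x
    unfolding G_def by (rule integral_eq_nn_integral) (auto simp: space intro!: less_imp_le kernel_pos)
  have "has_bochner_integral lborel (\<lambda>x. \<integral>z. k x z \<partial>P) 1"
  proof (rule has_bochner_integral_nn_integral)
    have "(\<integral>\<^sup>+x. ennreal (\<integral>z. k x z \<partial>P) \<partial>lborel) = (\<integral>\<^sup>+x. G x \<partial>lborel)"
      by (rule nn_integral_cong_AE) (use fin in \<open>auto simp: int_eq ennreal_enn2real less_top\<close>)
    then show "(\<integral>\<^sup>+x. ennreal (\<integral>z. k x z \<partial>P) \<partial>lborel) = ennreal 1" by (simp add: G1)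
  qed (auto simp: int_eq)
  then show "is_density (\<lambda>x. \<integral>z. k x z \<partial>P)" by (auto simp: is_density_def int_eq)
  show int: "AE x in lborel. integrable P (k x)"
    using fin
  proof eventually_elim
    case (elim x)
    then show ?case
      by (intro integrableI_nonneg) (auto simp: G_def space less_top intro!: less_imp_le kernel_pos)
  qed
  show "AE x in lborel. 0 < (\<integral>z. k x z \<partial>P)"
    using int
  proof eventually_elim
    case (elim x)
    have "AE z in P. 0 < k x z" by (intro AE_I2) (simp add: kernel_pos space)
    then show ?case using integral_less_AE_space[of "\<lambda>_. 0" "k x"] elim by (simp add: emeasure_space_1)
  qed
qed

end

lemma prob_space_density:
  assumes "is_density f" shows "prob_space (density lborel (\<lambda>x. ennreal (f x)))"
proof
  have "f \<in> borel_measurable lborel" "integrable lborel f"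
    using assms by (auto simp: is_density_def has_bochner_integral_iff)
  then show "emeasure (density lborel (\<lambda>x. ennreal (f x))) (space (density lborel (\<lambda>x. ennreal (f x)))) = 1"
    using assms by (auto simp: emeasure_density is_density_def has_bochner_integral_iff nn_integral_eq_integral)
qed

lemma borel_measurable_integral_subprob_algebra:
  fixes g :: "'a \<Rightarrow> 'b \<Rightarrow> real"
  assumes g: "(\<lambda>(p, z). g p z) \<in> borel_measurable (M \<Otimes>\<^sub>M N)"
    and L: "L \<in> M \<rightarrow>\<^sub>M subprob_algebra N"
    and nonneg: "\<And>p z. p \<in> space M \<Longrightarrow> z \<in> space N \<Longrightarrow> 0 \<le> g p z"
  shows "(\<lambda>p. \<integral>z. g p z \<partial>L p) \<in> borel_measurable M"
proof -
  have "(\<lambda>p. \<integral>\<^sup>+z. ennreal (g p z) \<partial>L p) \<in> borel_measurable M"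
    using g by (intro nn_integral_measurable_subprob_algebra2[OF _ L]) (simp add: split_beta')
  then have "(\<lambda>p. enn2real (\<integral>\<^sup>+z. ennreal (g p z) \<partial>L p)) \<in> borel_measurable M" by measurable
  then show ?thesis
  proof (rule measurable_cong[THEN iffD1, rotated])
    fix p assume p: "p \<in> space M"
    have sets: "sets (L p) = sets N" and space: "space (L p) = space N"
      using measurable_space[OF L p] by (auto simp: space_subprob_algebra dest: sets_eq_imp_space_eq)
    have "g p \<in> borel_measurable N"
      using measurable_compose[OF measurable_Pair1'[OF p] g] by simp
    then have "g p \<in> borel_measurable (L p)" by (simp add: measurable_cong_sets[OF sets refl])
    then show "enn2real (\<integral>\<^sup>+z. ennreal (g p z) \<partial>L p) = (\<integral>z. g p z \<partial>L p)"
      using nonneg[OF p] by (intro integral_eq_nn_integral[symmetric]) (auto simp: space)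
  qed
qed

section \<open>Weak neighbourhoods and Kullback-Leibler divergence\<close>

text \<open>
  The step from one mixing measure to a weak neighbourhood. A basic weak neighbourhood
  controls only finitely many integrals, here \<open>\<integral>z. K y z \<partial>P\<close> for finitely many \<open>y\<close>. The Harnack
  inequality is linear in the kernel, so it passes to these integrals, and it carries the control from a finite net of
  \<open>{-R..R}\<close> to the whole interval at the cost of a factor close to \<open>1\<close>, and from the point \<open>0\<close> to the
  whole line at the cost of a factor of polynomial growth.
\<close>

lemma weak_nbhd_kernel_integral:
  fixes S :: "'a::topological_space set" and K :: "real \<Rightarrow> 'a \<Rightarrow> real"
  assumes P0: "P0 \<in> prob_measures S"
    and K: "\<And>x. continuous_on S (K x)" "\<And>x. bounded (K x ` S)"
    and Harnack: "\<And>x y z. z \<in> S \<Longrightarrow> K x z \<le> (1 + \<bar>x - y\<bar> / b) powr s * K y z"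
    and pos: "\<And>x. 0 < (\<integral>z. K x z \<partial>P0)"
    and b: "b > 0" and s: "s > 0" and \<eta>: "\<eta> > 0"
  shows "\<exists>U. openin (weak_topology S) U \<and> P0 \<in> U \<and> (\<forall>P\<in>U. \<forall>x.
    (\<integral>z. K x z \<partial>P0) \<le> exp \<eta> * (if \<bar>x\<bar> \<le> R then 1 else (1 + \<bar>x\<bar> / b) powr (2 * s)) * (\<integral>z. K x z \<partial>P))"
proof -
  define H where "H t = (1 + \<bar>t\<bar> / b) powr s" for t
  have H1: "1 \<le> H t" for t using b s by (auto simp: H_def intro!: ge_one_powr_ge_zero)
  have Harnack_int: "(\<integral>z. K x z \<partial>P) \<le> H (x - y) * (\<integral>z. K y z \<partial>P)" if P: "P \<in> prob_measures S" for P x y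
  proof -
    have "(\<integral>z. K x z \<partial>P) \<le> (\<integral>z. H (x - y) * K y z \<partial>P)"
      using Harnack by (intro integral_mono integrable_mult_right integrable_bounded_continuous[OF P] K)
        (auto simp: prob_measuresD[OF P] H_def)
    then show ?thesis by simp
  qed
  \<comment> \<open>The mesh of the net is chosen such that two applications of the Harnack inequality at
    distance less than \<open>d\<close> cost at most \<open>exp (\<eta> / 2)\<close>; the other half of \<open>\<eta>\<close> is spent on the
    neighbourhood itself.\<close>
  define d where "d = b * (exp (\<eta> / (4 * s)) - 1)"
  have d: "d > 0" using b s \<eta> by (simp add: d_def)
  have H_small: "H t * H t \<le> exp (\<eta> / 2)" if "\<bar>t\<bar> < d" for t
  proof -
    have "1 + \<bar>t\<bar> / b \<le> exp (\<eta> / (4 * s))"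
      using that b by (simp add: d_def field_simps)
    then have "H t \<le> exp (\<eta> / (4 * s)) powr s"
      unfolding H_def using b s by (intro powr_mono2) auto
    also have "\<dots> = exp (\<eta> / 4)" using s by (simp add: powr_def)
    finally have "H t * H t \<le> exp (\<eta> / 4) * exp (\<eta> / 4)" using H1[of t] by (intro mult_mono) auto
    then show ?thesis by (simp add: exp_add[symmetric])
  qed
  obtain N where N: "finite N" "{-R..R} \<subseteq> (\<Union>y\<in>N. ball y d)"
  proof (rule compactE_image[of "{-R..R}" "{-R..R}" "\<lambda>y. ball y d"])
    show "{-R..R} \<subseteq> (\<Union>y\<in>{-R..R}. ball y d)" using d by force
  qed auto
  define W where "W y = {P \<in> prob_measures S. (\<integral>z. K y z \<partial>P) \<in> {exp (- \<eta> / 2) * (\<integral>z. K y z \<partial>P0) <..}}" for y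
  define U where "U = (\<Inter>y\<in>insert 0 N. W y)"
  have "openin (weak_topology S) (W y)" for y
    unfolding W_def by (intro openin_weak_topology_integral K) auto
  then have "openin (weak_topology S) U"
    unfolding U_def using N(1) by (intro openin_INT2) auto
  moreover have "P0 \<in> U"
    using P0 pos \<eta> by (auto simp: U_def W_def)
  moreover have "(\<integral>z. K x z \<partial>P0) \<le> exp \<eta> * (if \<bar>x\<bar> \<le> R then 1 else (1 + \<bar>x\<bar> / b) powr (2 * s)) * (\<integral>z. K x z \<partial>P)"
    if PU: "P \<in> U" for P x
  proof -
    have P: "P \<in> prob_measures S" using PU by (auto simp: U_def W_def)
    have via: "(\<integral>z. K x z \<partial>P0) \<le> exp (\<eta> / 2) * (H (x - y) * H (x - y)) * (\<integral>z. K x z \<partial>P)"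
      and pos_P: "0 < (\<integral>z. K x z \<partial>P)" if y: "y \<in> insert 0 N" for y
    proof -
      have "P \<in> W y" using PU y by (auto simp: U_def)
      then have "(\<integral>z. K y z \<partial>P0) < exp (\<eta> / 2) * (\<integral>z. K y z \<partial>P)"
        by (simp add: W_def exp_minus field_simps)
      moreover have "(\<integral>z. K y z \<partial>P) \<le> H (x - y) * (\<integral>z. K x z \<partial>P)"
        using Harnack_int[OF P, of y x] by (simp add: H_def abs_minus_commute)
      ultimately have le: "(\<integral>z. K y z \<partial>P0) < exp (\<eta> / 2) * (H (x - y) * (\<integral>z. K x z \<partial>P))"
        by (meson exp_gt_zero less_le_trans mult_left_mono less_imp_le)
      have "(\<integral>z. K x z \<partial>P0) \<le> H (x - y) * (\<integral>z. K y z \<partial>P0)" by (rule Harnack_int[OF P0])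
      also have "\<dots> \<le> H (x - y) * (exp (\<eta> / 2) * (H (x - y) * (\<integral>z. K x z \<partial>P)))"
        using le H1[of "x - y"] by (intro mult_left_mono) auto
      finally show "(\<integral>z. K x z \<partial>P0) \<le> exp (\<eta> / 2) * (H (x - y) * H (x - y)) * (\<integral>z. K x z \<partial>P)"
        by (simp add: mult_ac)
      have "0 < exp (\<eta> / 2) * H (x - y)" using H1[of "x - y"] by simp
      moreover have "0 < exp (\<eta> / 2) * H (x - y) * (\<integral>z. K x z \<partial>P)"
        using le pos[of y] by (simp add: mult.assoc)
      ultimately show "0 < (\<integral>z. K x z \<partial>P)" using zero_less_mult_pos by blast
    qed
    show ?thesis
    proof (cases "\<bar>x\<bar> \<le> R")
      case True
      then have "x \<in> {-R..R}" by auto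
      then obtain y where y: "y \<in> N" "dist y x < d" using N(2) by auto
      have "exp (\<eta> / 2) * (H (x - y) * H (x - y)) \<le> exp (\<eta> / 2) * exp (\<eta> / 2)"
        using y by (intro mult_left_mono H_small) (auto simp: dist_real_def abs_minus_commute)
      then have "exp (\<eta> / 2) * (H (x - y) * H (x - y)) * (\<integral>z. K x z \<partial>P) \<le> exp \<eta> * (\<integral>z. K x z \<partial>P)"
        using pos_P[of y] y by (intro mult_right_mono) (auto simp: exp_add[symmetric])
      then show ?thesis using via[of y] y True by simp
    next
      case False
      have "exp (\<eta> / 2) * (H x * H x) \<le> exp \<eta> * (1 + \<bar>x\<bar> / b) powr (2 * s)"
        using \<eta> by (intro mult_mono) (auto simp: H_def powr_add[symmetric])
      then have "exp (\<eta> / 2) * (H x * H x) * (\<integral>z. K x z \<partial>P) \<le> exp \<eta> * (1 + \<bar>x\<bar> / b) powr (2 * s) * (\<integral>z. K x z \<partial>P)"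
        using pos_P[of 0] by (intro mult_right_mono) auto
      then show ?thesis using via[of 0] False by simp
    qed
  qed
  ultimately show ?thesis by blast
qed

text \<open>
  If \<open>F / f\<close> is at most slightly above \<open>1\<close> on \<open>{-R..R}\<close> and of at most polynomial growth outside,
  then passing from \<open>F\<close> to \<open>f\<close> increases the divergence from \<open>f0\<close> by at most a small constant plus a multiple of
  the integral of \<open>f0 x * ln (1 + \<bar>x\<bar> / b)\<close> over \<open>\<bar>x\<bar> > R\<close>. The logarithmic moment of \<open>f0\<close> makes
  that tail small for large \<open>R\<close>. Both \<open>\<eta>\<close> and \<open>R\<close> are chosen before \<open>f\<close>, so that they may
  determine the weak neighbourhood from which \<open>f\<close> is drawn.
\<close>

lemma KL_div_less_of_ratio_bound:
  fixes f0 F :: "real \<Rightarrow> real"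
  assumes f0: "is_density f0" and f0_pos: "\<And>x. 0 < f0 x"
    and F_pos: "\<And>x. 0 < F x"
    and int: "integrable lborel (\<lambda>x. f0 x * ln (f0 x / F x))"
    and less: "(\<integral>x. f0 x * ln (f0 x / F x) \<partial>lborel) < \<epsilon>"
    and log_moment: "integrable lborel (\<lambda>x. log_plus \<bar>x\<bar> * f0 x)"
    and b: "b > 0" and s: "s \<ge> 0"
  obtains \<eta> R where "\<eta> > 0"
    "\<And>f. is_density f \<Longrightarrow> AE x in lborel. F x \<le> exp \<eta> * (if \<bar>x\<bar> \<le> R then 1 else (1 + \<bar>x\<bar> / b) powr s) * f x
      \<Longrightarrow> KL_div f0 f < ereal \<epsilon>"
proof -
  have f0_int: "integrable lborel f0" "(\<integral>x. f0 x \<partial>lborel) = 1"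
    using f0 by (auto simp: is_density_def has_bochner_integral_iff)
  have [measurable]: "f0 \<in> borel_measurable borel" using f0_int(1) borel_measurable_integrable by force
  define L where "L x = s * ln (1 + \<bar>x\<bar> / b)" for x
  have L_nonneg: "0 \<le> L x" for x using b s by (simp add: L_def)
  have [measurable]: "L \<in> borel_measurable borel" unfolding L_def by measurable
  have L_le: "L x \<le> s * ln (1 + 1 / b) + s * log_plus \<bar>x\<bar>" for x
  proof -
    have "ln (1 + \<bar>x\<bar> / b) \<le> ln (1 + 1 / b) + log_plus \<bar>x\<bar>"
    proof (cases "\<bar>x\<bar> \<le> 1")
      case True
      then have "1 + \<bar>x\<bar> / b \<le> 1 + 1 / b" using b by (simp add: divide_right_mono)
      then have "ln (1 + \<bar>x\<bar> / b) \<le> ln (1 + 1 / b)"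
        using b by (intro ln_mono) (auto intro!: add_pos_nonneg)
      then show ?thesis by (simp add: log_plus_def)
    next
      case False
      then have "1 + \<bar>x\<bar> / b \<le> (1 + 1 / b) * \<bar>x\<bar>" using b by (simp add: field_simps)
      then have "ln (1 + \<bar>x\<bar> / b) \<le> ln ((1 + 1 / b) * \<bar>x\<bar>)"
        using b by (intro ln_mono) (auto intro!: add_pos_nonneg)
      also have "\<dots> = ln (1 + 1 / b) + ln \<bar>x\<bar>"
        using b False by (intro ln_mult_pos) (auto intro!: add_pos_nonneg)
      finally show ?thesis by (simp add: log_plus_def)
    qed
    then show ?thesis using s unfolding L_def by (simp add: mult_left_mono flip: distrib_left)
  qed
  define T where "T R x = f0 x * (if \<bar>x\<bar> \<le> R then 0 else L x)" for R x
  have [measurable]: "T R \<in> borel_measurable borel" for R unfolding T_def by measurable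
  define w where "w x = s * ln (1 + 1 / b) * f0 x + s * (log_plus \<bar>x\<bar> * f0 x)" for x
  have w: "integrable lborel w" unfolding w_def using f0_int log_moment by auto
  have T_le: "norm (T R x) \<le> w x" for R x
  proof -
    have "norm (T R x) \<le> f0 x * L x"
      using f0_pos[of x] L_nonneg[of x] by (auto simp: T_def)
    also have "\<dots> \<le> f0 x * (s * ln (1 + 1 / b) + s * log_plus \<bar>x\<bar>)"
      using f0_pos[of x] L_le by (intro mult_left_mono) auto
    finally show ?thesis by (simp add: w_def algebra_simps)
  qed
  have T_int: "integrable lborel (T R)" for R
    by (rule Bochner_Integration.integrable_bound[OF w]) (use T_le in \<open>auto intro: order_trans[OF _ abs_ge_self]\<close>)
  have "(\<lambda>n. \<integral>x. T (real n) x \<partial>lborel) \<longlonglongrightarrow> (\<integral>x. 0 \<partial>(lborel :: real measure))"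
  proof (rule integral_dominated_convergence[OF _ _ w])
    show "AE x in lborel. (\<lambda>n. T (real n) x) \<longlonglongrightarrow> 0"
    proof (rule AE_I2)
      fix x :: real
      have "\<forall>\<^sub>F n in sequentially. T (real n) x = 0"
        using eventually_ge_at_top[of "nat \<lceil>\<bar>x\<bar>\<rceil>"]
        by eventually_elim (auto simp: T_def nat_le_iff ceiling_le_iff)
      then show "(\<lambda>n. T (real n) x) \<longlonglongrightarrow> 0" by (rule tendsto_eventually)
    qed
  qed (use T_le in auto)
  moreover define \<gamma> where "\<gamma> = \<epsilon> - (\<integral>x. f0 x * ln (f0 x / F x) \<partial>lborel)"
  have \<gamma>: "\<gamma> > 0" using less by (simp add: \<gamma>_def)
  ultimately have "\<forall>\<^sub>F n in sequentially. (\<integral>x. T (real n) x \<partial>lborel) < \<gamma> / 3"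
    by (intro order_tendstoD) auto
  then obtain n where n: "(\<integral>x. T (real n) x \<partial>lborel) < \<gamma> / 3" by (auto simp: eventually_sequentially)
  show thesis
  proof (rule that[of "\<gamma> / 3" "real n"])
    fix f :: "real \<Rightarrow> real"
    assume f: "is_density f" and ratio:
      "AE x in lborel. F x \<le> exp (\<gamma> / 3) * (if \<bar>x\<bar> \<le> real n then 1 else (1 + \<bar>x\<bar> / b) powr s) * f x"
    have f_int: "integrable lborel f" using f by (auto simp: is_density_def has_bochner_integral_iff)
    have [measurable]: "f \<in> borel_measurable borel" using f_int borel_measurable_integrable by force
    define B where "B x = f0 x * ln (f0 x / F x) + \<gamma> / 3 * f0 x + T (real n) x" for x
    have B_int: "integrable lborel B" unfolding B_def using int f0_int T_int by auto
    have bounds: "AE x in lborel. 0 < f x \<and> f0 x - f x \<le> f0 x * ln (f0 x / f x) \<and> f0 x * ln (f0 x / f x) \<le> B x"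
      using ratio
    proof eventually_elim
      case (elim x)
      let ?c = "if \<bar>x\<bar> \<le> real n then 1 else (1 + \<bar>x\<bar> / b) powr s"
      have c: "?c > 0" "ln ?c = (if \<bar>x\<bar> \<le> real n then 0 else L x)"
        using b add_pos_nonneg[of 1 "\<bar>x\<bar> / b"] by (auto simp: L_def ln_powr)
      have "0 < exp (\<gamma> / 3) * ?c * f x" using elim F_pos[of x] by linarith
      moreover have "0 < exp (\<gamma> / 3) * ?c" using c(1) by simp
      ultimately have fx: "0 < f x" using zero_less_mult_pos by blast
      have "ln (F x) \<le> ln (exp (\<gamma> / 3) * ?c * f x)"
        using elim F_pos[of x] by (intro ln_mono) auto
      also have "\<dots> = \<gamma> / 3 + ln ?c + ln (f x)"
        using c(1) fx by (simp add: ln_mult_pos del: if_split)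
      finally have "ln (f0 x / f x) \<le> ln (f0 x / F x) + \<gamma> / 3 + (if \<bar>x\<bar> \<le> real n then 0 else L x)"
        using f0_pos[of x] fx F_pos[of x] c(2) by (simp add: ln_div)
      then have "f0 x * ln (f0 x / f x) \<le> f0 x * (ln (f0 x / F x) + \<gamma> / 3 + (if \<bar>x\<bar> \<le> real n then 0 else L x))"
        using f0_pos[of x] by (intro mult_left_mono) auto
      then have up: "f0 x * ln (f0 x / f x) \<le> B x" by (simp add: B_def T_def algebra_simps)
      \<comment> \<open>The lower bound makes the integrand integrable whatever the tails of \<open>f\<close> are.\<close>
      have "ln (f x / f0 x) \<le> f x / f0 x - 1" using fx f0_pos[of x] by (intro ln_le_minus_one) auto
      then have "f0 x * ln (f x / f0 x) \<le> f0 x * (f x / f0 x - 1)" using f0_pos[of x] by (intro mult_left_mono) auto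
      also have "\<dots> = f x - f0 x" using f0_pos[of x] by (simp add: field_simps)
      finally have "f0 x - f x \<le> f0 x * ln (f0 x / f x)"
        using f0_pos[of x] fx by (simp add: ln_div right_diff_distrib)
      with up fx show ?case by simp
    qed
    have KL_int: "integrable lborel (\<lambda>x. f0 x * ln (f0 x / f x))"
    proof (rule Bochner_Integration.integrable_bound)
      show "integrable lborel (\<lambda>x. \<bar>B x\<bar> + \<bar>f0 x - f x\<bar>)" using B_int f0_int f_int by auto
      show "AE x in lborel. norm (f0 x * ln (f0 x / f x)) \<le> norm (\<bar>B x\<bar> + \<bar>f0 x - f x\<bar>)"
        using bounds by eventually_elim auto
    qed measurable
    have "(\<integral>x. f0 x * ln (f0 x / f x) \<partial>lborel) \<le> (\<integral>x. B x \<partial>lborel)"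
      using KL_int B_int bounds by (intro integral_mono_AE) auto
    also have "\<dots> = (\<epsilon> - \<gamma>) + \<gamma> / 3 + (\<integral>x. T (real n) x \<partial>lborel)"
      using int f0_int T_int unfolding B_def by (simp add: \<gamma>_def)
    also have "\<dots> < \<epsilon>" using n \<gamma> by simp
    finally show "KL_div f0 f < ereal \<epsilon>"
      using KL_int bounds unfolding KL_div_def by (auto intro: eventually_mono)
  qed (use \<gamma> in auto)
qed

lemma local_inf_bounds:
  assumes "continuous_on UNIV f" "\<And>x. 0 < f x" "\<delta> > 0"
  shows "0 < local_inf \<delta> f x" and "\<bar>t - x\<bar> < \<delta> \<Longrightarrow> local_inf \<delta> f x \<le> f t"
proof -
  obtain m where m: "m \<in> {x - \<delta>..x + \<delta>}" "\<And>t. t \<in> {x - \<delta>..x + \<delta>} \<Longrightarrow> f m \<le> f t"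
    using continuous_attains_inf[of "{x - \<delta>..x + \<delta>}" f] continuous_on_subset[OF assms(1) subset_UNIV] assms(3)
    by auto
  have "f m \<le> local_inf \<delta> f x"
    unfolding local_inf_def using assms(3) m(2)
    by (intro cINF_greatest) (auto simp: abs_less_iff intro!: exI[of _ x] less_imp_le)
  then show "0 < local_inf \<delta> f x" using assms(2)[of m] by simp
  have "bdd_below (f ` {t. \<bar>t - x\<bar> < \<delta>})" using assms(2) by (intro bdd_belowI[of _ 0]) (auto intro: less_imp_le)
  then show "local_inf \<delta> f x \<le> f t" if "\<bar>t - x\<bar> < \<delta>"
    unfolding local_inf_def using that by (intro cINF_lower) auto
qed

text \<open>
  Smoothing \<open>f0\<close> at a small scale changes it little in Kullback-Leibler divergence. Since \<open>f0\<close> is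
  continuous and bounded, \<open>F h\<close> converges to \<open>f0\<close> pointwise as \<open>h\<close> tends to \<open>0\<close>, and the
  integrands are dominated: \<open>F h \<le> M\<close> bounds them from below by means of the entropy of \<open>f0\<close>, and
  \<open>F h \<ge> c * local_inf \<delta> f0\<close> for \<open>h \<le> 1\<close>, where \<open>c\<close> is the mass that \<open>\<kappa>\<close> gives to \<open>{-\<delta><..<\<delta>}\<close>, bounds them from
  above by means of the assumption on \<^const>\<open>local_inf\<close>.
\<close>

lemma KL_smoothing_small:
  fixes f0 \<kappa> :: "real \<Rightarrow> real"
  defines "F \<equiv> \<lambda>h x. \<integral>u. \<kappa> u * f0 (x - h * u) \<partial>lborel"
  assumes f0: "is_density f0" and cont: "continuous_on UNIV f0"
    and f0_pos: "\<And>x. 0 < f0 x" and f0_le: "\<And>x. f0 x \<le> M"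
    and entropy: "integrable lborel (\<lambda>x. f0 x * ln (f0 x))"
    and local_inf: "integrable lborel (\<lambda>x. f0 x * ln (f0 x / local_inf \<delta> f0 x))" and \<delta>: "\<delta> > 0"
    and \<kappa>: "is_density \<kappa>" and \<kappa>_pos: "\<And>u. 0 < \<kappa> u"
    and \<epsilon>: "\<epsilon> > 0"
  obtains h where "h > 0" "\<And>x. 0 < F h x"
    "integrable lborel (\<lambda>x. f0 x * ln (f0 x / F h x))"
    "(\<integral>x. f0 x * ln (f0 x / F h x) \<partial>lborel) < \<epsilon>"
proof -
  have f0_int: "integrable lborel f0" and \<kappa>_int: "integrable lborel \<kappa>" "(\<integral>x. \<kappa> x \<partial>lborel) = 1"
    using f0 \<kappa> by (auto simp: is_density_def has_bochner_integral_iff)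
  have [measurable]: "f0 \<in> borel_measurable borel" "\<kappa> \<in> borel_measurable borel"
    using f0_int \<kappa>_int borel_measurable_integrable by force+
  have [measurable]: "F h \<in> borel_measurable lborel" for h
    unfolding F_def by measurable
  define d where "d = local_inf \<delta> f0"
  note d = local_inf_bounds[OF cont f0_pos \<delta>, folded d_def]
  have d_le: "d x \<le> f0 x" for x using d(2)[of x x] \<delta> by simp
  have M: "M > 0" using f0_pos[of 0] f0_le[of 0] by linarith
  have integrand: "integrable lborel (\<lambda>u. \<kappa> u * f0 (x - h * u))" for h x
    using f0_le f0_pos \<kappa>_pos by (intro Bochner_Integration.integrable_bound[OF integrable_mult_left[OF \<kappa>_int(1), of M]])
      (auto simp: abs_mult less_imp_le mult_left_mono abs_of_pos M)
  define c where "c = (\<integral>u. indicator {-\<delta><..<\<delta>} u * \<kappa> u \<partial>lborel)"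
  have c_int: "integrable lborel (\<lambda>u. indicator {-\<delta><..<\<delta>} u * \<kappa> u)"
    using integrable_mult_indicator[OF _ \<kappa>_int(1), of "{-\<delta><..<\<delta>}"] by simp
  have c: "c > 0"
  proof -
    have nonneg: "0 \<le> indicator {-\<delta><..<\<delta>} u * \<kappa> u" for u using \<kappa>_pos[of u] by simp
    have "c \<noteq> 0"
    proof
      assume "c = 0"
      then have "AE u in lborel. indicator {-\<delta><..<\<delta>} u * \<kappa> u = 0"
        using integral_nonneg_eq_0_iff_AE[OF c_int] nonneg by (simp add: c_def)
      then have "AE u in lborel. u \<notin> {-\<delta><..<\<delta>}"
        using \<kappa>_pos by (auto elim!: eventually_mono simp: indicator_def less_imp_neq[symmetric] split: if_splits)
      then have "{-\<delta><..<\<delta>} \<in> null_sets lborel" by (subst AE_iff_null_sets) auto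
      then show False using \<delta> by auto
    qed
    moreover have "0 \<le> c" unfolding c_def by (rule Bochner_Integration.integral_nonneg) (rule nonneg)
    ultimately show ?thesis by simp
  qed
  have F_ge: "c * d x \<le> F h x" if "0 < h" "h \<le> 1" for h x
  proof -
    have "c * d x = (\<integral>u. indicator {-\<delta><..<\<delta>} u * \<kappa> u * d x \<partial>lborel)" by (simp add: c_def)
    also have "\<dots> \<le> F h x" unfolding F_def
    proof (rule integral_mono)
      fix u :: real
      show "indicator {-\<delta><..<\<delta>} u * \<kappa> u * d x \<le> \<kappa> u * f0 (x - h * u)"
      proof (cases "u \<in> {-\<delta><..<\<delta>}")
        case True
        have "\<bar>h * u\<bar> \<le> 1 * \<bar>u\<bar>" using that by (subst abs_mult, intro mult_right_mono) auto
        then have "\<bar>(x - h * u) - x\<bar> < \<delta>" using True by auto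
        then show ?thesis using d(2) True \<kappa>_pos[of u] by (simp add: mult_left_mono)
      qed (use \<kappa>_pos[of u] f0_pos[of "x - h * u"] in auto)
    qed (use c_int integrand in auto)
    finally show ?thesis .
  qed
  have F_pos: "0 < F h x" if "0 < h" "h \<le> 1" for h x
    using F_ge[OF that, of x] c d(1)[of x] by (meson less_le_trans mult_pos_pos)
  have F_le: "F h x \<le> M" for h x
  proof -
    have "F h x \<le> (\<integral>u. \<kappa> u * M \<partial>lborel)"
      unfolding F_def using integrand \<kappa>_int f0_le \<kappa>_pos
      by (intro integral_mono) (auto simp: less_imp_le mult_left_mono)
    then show ?thesis using \<kappa>_int by simp
  qed
  define hs where "hs n = 1 / real (Suc n)" for n
  have hs: "0 < hs n" "hs n \<le> 1" for n by (auto simp: hs_def)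
  have hs_lim: "hs \<longlonglongrightarrow> 0" unfolding hs_def by (rule LIMSEQ_Suc[OF lim_1_over_n])
  have F_lim: "(\<lambda>n. F (hs n) x) \<longlonglongrightarrow> f0 x" for x
  proof -
    have "(\<lambda>n. F (hs n) x) \<longlonglongrightarrow> (\<integral>u. \<kappa> u * f0 x \<partial>lborel)"
      unfolding F_def
    proof (rule integral_dominated_convergence[where w = "\<lambda>u. \<kappa> u * M"])
      show "AE u in lborel. (\<lambda>n. \<kappa> u * f0 (x - hs n * u)) \<longlonglongrightarrow> \<kappa> u * f0 x"
      proof (intro AE_I2 tendsto_mult tendsto_const)
        fix u
        have "isCont f0 x" using cont by (simp add: continuous_on_eq_continuous_at)
        moreover have "(\<lambda>n. x - hs n * u) \<longlonglongrightarrow> x - 0 * u" by (intro tendsto_intros hs_lim)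
        ultimately show "(\<lambda>n. f0 (x - hs n * u)) \<longlonglongrightarrow> f0 x"
          by (intro isCont_tendsto_compose[of x f0]) auto
      qed
      show "AE u in lborel. norm (\<kappa> u * f0 (x - hs n * u)) \<le> \<kappa> u * M" for n
        using f0_le f0_pos \<kappa>_pos by (auto simp: abs_mult less_imp_le mult_left_mono abs_of_pos)
    qed (use \<kappa>_int in auto)
    then show ?thesis using \<kappa>_int by simp
  qed
  define w where "w x = \<bar>f0 x * ln (f0 x)\<bar> + \<bar>ln M\<bar> * f0 x + f0 x * ln (f0 x / d x) + \<bar>ln c\<bar> * f0 x" for x
  have w: "integrable lborel w"
    unfolding w_def d_def using entropy local_inf f0_int by (intro Bochner_Integration.integrable_add) auto
  have bound: "norm (f0 x * ln (f0 x / F (hs n) x)) \<le> w x" for n x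
  proof -
    have pos: "0 < F (hs n) x" by (rule F_pos[OF hs])
    have "ln (c * d x) \<le> ln (F (hs n) x)"
      using F_ge[OF hs, of x n] c d(1)[of x] by (intro ln_mono) auto
    then have up: "ln (f0 x / F (hs n) x) \<le> ln (f0 x / d x) - ln c"
      using c d(1)[of x] f0_pos[of x] pos by (simp add: ln_div ln_mult_pos)
    have "ln (F (hs n) x) \<le> ln M" using F_le pos by (intro ln_mono) auto
    then have lo: "ln (f0 x) - ln M \<le> ln (f0 x / F (hs n) x)" using f0_pos[of x] pos by (simp add: ln_div)
    have "0 \<le> ln (f0 x / d x)" using d_le[of x] d(1)[of x] by simp
    with up lo have "\<bar>ln (f0 x / F (hs n) x)\<bar> \<le> \<bar>ln (f0 x)\<bar> + \<bar>ln M\<bar> + ln (f0 x / d x) + \<bar>ln c\<bar>" by linarith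
    then have "f0 x * \<bar>ln (f0 x / F (hs n) x)\<bar> \<le> f0 x * (\<bar>ln (f0 x)\<bar> + \<bar>ln M\<bar> + ln (f0 x / d x) + \<bar>ln c\<bar>)"
      using f0_pos[of x] by (intro mult_left_mono) auto
    then show ?thesis using f0_pos[of x] by (simp add: w_def abs_mult algebra_simps)
  qed
  have lim: "(\<lambda>n. f0 x * ln (f0 x / F (hs n) x)) \<longlonglongrightarrow> 0" for x
  proof -
    have "(\<lambda>n. f0 x * ln (f0 x / F (hs n) x)) \<longlonglongrightarrow> f0 x * ln (f0 x / f0 x)"
      using f0_pos[of x] by (intro tendsto_intros F_lim) auto
    then show ?thesis using f0_pos[of x] by simp
  qed
  have int: "integrable lborel (\<lambda>x. f0 x * ln (f0 x / F (hs n) x))" for n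
    by (rule Bochner_Integration.integrable_bound[OF w]) (use bound in \<open>auto intro: order_trans[OF _ abs_ge_self]\<close>)
  have "(\<lambda>n. \<integral>x. f0 x * ln (f0 x / F (hs n) x) \<partial>lborel) \<longlonglongrightarrow> (\<integral>x. 0 \<partial>(lborel :: real measure))"
    by (rule integral_dominated_convergence[OF _ _ w]) (use lim bound in auto)
  then have "\<forall>\<^sub>F n in sequentially. (\<integral>x. f0 x * ln (f0 x / F (hs n) x) \<partial>lborel) < \<epsilon>"
    using \<epsilon> by (intro order_tendstoD) auto
  then obtain n where "(\<integral>x. f0 x * ln (f0 x / F (hs n) x) \<partial>lborel) < \<epsilon>" by (auto simp: eventually_sequentially)
  then show thesis using that[of "hs n"] hs F_pos int by blast
qed

section \<open>Kullback-Leibler support of location-scale mixture priors\<close>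

text \<open>
  The centre of the neighbourhood is the law of \<open>(\<theta>, h)\<close> with \<open>\<theta>\<close> distributed according to \<open>f0\<close>; its
  mixture is the smoothing \<open>F\<close> of \<open>f0\<close> at scale \<open>h\<close>. As a function of \<open>(\<theta>, \<phi>)\<close> the kernel
  \<open>k x\<close> is unbounded near \<open>\<phi> = 0\<close>, and its Harnack constant degenerates there, so it is multiplied by
  a continuous cutoff \<open>w \<phi>\<close> that vanishes for \<open>\<phi> \<le> h / 2\<close>. As \<open>w h = 1\<close>, the cutoff does not
  change the mixture at the centre, and at other mixing measures it only decreases the mixture,
  which is harmless for an upper bound on the divergence from \<open>f0\<close>.
\<close>

lemma KL_ball_mixture_I:
  assumes \<nu>: "\<nu> > 0" and Q: "prior_on_measures (UNIV \<times> {0<..}) Q" and supp: "full_support_I Q"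
    and f0: "is_density f0" and f0_pos: "\<And>x. 0 < f0 x"
    and log_moment: "integrable lborel (\<lambda>x. log_plus \<bar>x\<bar> * f0 x)"
    and h: "h > 0"
    and F_def: "\<And>x. F x = (\<integral>u. student_t_density \<nu> u * f0 (x - h * u) \<partial>lborel)"
    and F_pos: "\<And>x. 0 < F x"
    and F_int: "integrable lborel (\<lambda>x. f0 x * ln (f0 x / F x))"
    and F_less: "(\<integral>x. f0 x * ln (f0 x / F x) \<partial>lborel) < \<epsilon>"
  shows "emeasure (mixture_prior_I (student_t_density \<nu>) Q) {f. is_density f \<and> KL_div f0 f < ereal \<epsilon>} > 0"
proof -
  let ?S = "UNIV \<times> {0<..} :: (real \<times> real) set"
  let ?N = "restrict_space borel ?S"
  define b where "b = h / 2 * sqrt \<nu>"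
  have b: "b > 0" using h \<nu> by (simp add: b_def)
  obtain \<eta> R where \<eta>: "\<eta> > 0" and ratio: "\<And>f. is_density f \<Longrightarrow>
      AE x in lborel. F x \<le> exp \<eta> * (if \<bar>x\<bar> \<le> R then 1 else (1 + \<bar>x\<bar> / b) powr (2 * (\<nu> + 1))) * f x
      \<Longrightarrow> KL_div f0 f < ereal \<epsilon>"
    using KL_div_less_of_ratio_bound[OF f0 f0_pos F_pos F_int F_less log_moment b, of "2 * (\<nu> + 1)"] \<nu> by auto
  have f0_meas [measurable]: "f0 \<in> borel_measurable borel"
    using f0 borel_measurable_integrable by (force simp: is_density_def has_bochner_integral_iff)
  have S_sets: "?S \<in> sets borel" by (intro borel_open open_Times) auto
  have space_N: "space ?N = ?S" by (simp add: space_restrict_space)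
  have proj [measurable]: "fst \<in> borel_measurable ?N" "snd \<in> borel_measurable ?N"
    by (auto intro!: borel_measurable_continuous_on_restrict continuous_intros)
  define k where "k x z = t_kernel \<nu> x (fst z) (snd z)" for x and z :: "real \<times> real"
  have mix: "mixture_density_I (student_t_density \<nu>) P x = (\<integral>z. k x z \<partial>P)" for P x
    by (simp add: mixture_density_I_def k_def t_kernel_def split_beta')
  interpret density_kernel ?N k
    by standard (use \<nu> in \<open>auto simp: k_def space_N t_kernel_pos nn_integral_t_kernel\<close>)

  define w where "w \<phi> = max 0 (min 1 (2 * \<phi> / h - 1))" for \<phi>
  have w: "0 \<le> w \<phi>" "w \<phi> \<le> 1" "w h = 1" "\<phi> \<le> h / 2 \<Longrightarrow> w \<phi> = 0" for \<phi>
    using h by (auto simp: w_def field_simps)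
  define K where "K x z = w (snd z) * k x z" for x z
  have K_cont: "continuous_on ?S (K x)" for x
    unfolding K_def k_def w_def using \<nu> h by (intro continuous_intros) auto
  have K_nonneg: "0 \<le> K x z" if "z \<in> ?S" for x z
    using that \<nu> w by (auto simp: K_def k_def intro!: mult_nonneg_nonneg less_imp_le[OF t_kernel_pos])
  have K_le_k: "K x z \<le> k x z" if "z \<in> ?S" for x z
    using that \<nu> w mult_right_mono[of "w (snd z)" 1 "k x z"]
    by (auto simp: K_def k_def less_imp_le[OF t_kernel_pos])
  have K_bounded: "bounded (K x ` ?S)" for x
    unfolding bounded_iff
  proof (intro exI ballI)
    fix y assume "y \<in> K x ` ?S"
    then obtain z where z: "z \<in> ?S" "y = K x z" by auto
    have "K x z \<le> student_t_density \<nu> 0 / (h / 2)"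
    proof (cases "snd z \<le> h / 2")
      case True
      then show ?thesis using w(4) h \<nu> student_t_density_pos[OF \<nu>, of 0] by (simp add: K_def)
    next
      case False
      have "k x z \<le> student_t_density \<nu> 0 / snd z"
        unfolding k_def using z \<nu> by (intro t_kernel_le) auto
      also have "\<dots> \<le> student_t_density \<nu> 0 / (h / 2)"
        using False h student_t_density_pos[OF \<nu>, of 0] by (intro divide_left_mono) auto
      finally show ?thesis using K_le_k[OF z(1), of x] by simp
    qed
    then show "norm y \<le> student_t_density \<nu> 0 / (h / 2)" using K_nonneg[OF z(1), of x] z(2) by simp
  qed
  have K_Harnack: "K x z \<le> (1 + \<bar>x - y\<bar> / b) powr (\<nu> + 1) * K y z" if "z \<in> ?S" for x y z
  proof (cases "snd z \<le> h / 2")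
    case True
    then show ?thesis using w(4) by (simp add: K_def)
  next
    case False
    have "k x z \<le> (1 + \<bar>x - y\<bar> / b) powr (\<nu> + 1) * k y z"
      unfolding k_def b_def using False h \<nu> by (intro t_kernel_Harnack) auto
    then have "w (snd z) * k x z \<le> w (snd z) * ((1 + \<bar>x - y\<bar> / b) powr (\<nu> + 1) * k y z)"
      using w by (intro mult_left_mono) auto
    then show ?thesis by (simp add: K_def mult_ac)
  qed

  define P0 where "P0 = distr (density lborel (\<lambda>\<theta>. ennreal (f0 \<theta>))) ?N (\<lambda>\<theta>. (\<theta>, h))"
  have pair_h: "(\<lambda>\<theta>. (\<theta>, h)) \<in> density lborel (\<lambda>\<theta>. ennreal (f0 \<theta>)) \<rightarrow>\<^sub>M ?N"
    using h by (intro measurable_restrict_space2) (auto simp: borel_prod[symmetric])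
  have P0: "P0 \<in> prob_measures ?S"
    unfolding prob_measures_def P0_def
    using prob_space.prob_space_distr[OF prob_space_density[OF f0] pair_h] by simp
  have K_P0: "(\<integral>z. K x z \<partial>P0) = F x" for x
  proof -
    have "(\<integral>z. K x z \<partial>P0) = (\<integral>\<theta>. K x (\<theta>, h) \<partial>density lborel (\<lambda>\<theta>. ennreal (f0 \<theta>)))"
      unfolding P0_def by (rule integral_distr[OF pair_h]) (rule borel_measurable_continuous_on_restrict[OF K_cont])
    then show ?thesis using w(3) integral_t_kernel_density[OF f0 h] by (simp add: K_def k_def F_def)
  qed
  obtain U where U: "openin (weak_topology ?S) U" "P0 \<in> U"
    and U_ratio: "\<And>P x. P \<in> U \<Longrightarrow>
      F x \<le> exp \<eta> * (if \<bar>x\<bar> \<le> R then 1 else (1 + \<bar>x\<bar> / b) powr (2 * (\<nu> + 1))) * (\<integral>z. K x z \<partial>P)"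
    using weak_nbhd_kernel_integral[OF P0 K_cont K_bounded K_Harnack _ b _ \<eta>, of R] F_pos \<nu>
    unfolding K_P0 by auto

  show ?thesis
    unfolding mixture_prior_I_def
  proof (rule emeasure_law_KL_ball_pos[OF _ f0_meas])
    show "(\<lambda>(P, x). mixture_density_I (student_t_density \<nu>) P x) \<in> borel_measurable (Q \<Otimes>\<^sub>M lborel)"
      unfolding mix split_beta'
    proof (rule borel_measurable_integral_subprob_algebra[where N = ?N])
      show "fst \<in> Q \<Otimes>\<^sub>M lborel \<rightarrow>\<^sub>M subprob_algebra ?N"
        by (rule measurable_compose[OF measurable_fst measurable_prior_subprob_algebra[OF Q S_sets]])
      show "(\<lambda>(p, z). k (snd p) z) \<in> borel_measurable ((Q \<Otimes>\<^sub>M lborel) \<Otimes>\<^sub>M ?N)"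
        unfolding k_def by measurable
    qed (use \<nu> in \<open>auto simp: k_def space_N intro!: less_imp_le[OF t_kernel_pos]\<close>)
    fix P assume "P \<in> space Q"
    then have P: "P \<in> prob_measures ?S" by (simp add: space_prior[OF Q])
    note mixture = mixture_density[OF prob_measuresD(1,2)[OF P]]
    show "is_density (mixture_density_I (student_t_density \<nu>) P)"
      using mixture(1) by (simp add: mix[abs_def])
    show "AE x in lborel. 0 < mixture_density_I (student_t_density \<nu>) P x"
      using mixture(3) by (simp add: mix)
  next
    show "U \<in> sets Q" by (rule openin_sets_prior[OF Q U(1)])
    show "0 < emeasure Q U"
      using supp P0 U unfolding full_support_I_def support_in_def by blast
    fix P assume PU: "P \<in> U"
    then have P: "P \<in> prob_measures ?S" using openin_subset[OF U(1)] by auto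
    note mixture = mixture_density[OF prob_measuresD(1,2)[OF P]]
    have "AE x in lborel. F x \<le> exp \<eta> * (if \<bar>x\<bar> \<le> R then 1 else (1 + \<bar>x\<bar> / b) powr (2 * (\<nu> + 1))) * (\<integral>z. k x z \<partial>P)"
      using mixture(2)
    proof eventually_elim
      case (elim x)
      have "(\<integral>z. K x z \<partial>P) \<le> (\<integral>z. k x z \<partial>P)"
        using elim K_le_k by (intro integral_mono integrable_bounded_continuous[OF P K_cont K_bounded])
          (auto simp: prob_measuresD[OF P])
      then show ?case
        by (rule order_trans[OF U_ratio[OF PU] mult_left_mono]) auto
    qed
    then show "KL_div f0 (mixture_density_I (student_t_density \<nu>) P) < ereal \<epsilon>"
      using mixture(1) by (intro ratio) (simp_all add: mix[abs_def])
  qed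
qed

text \<open>
  For the fixed scale \<open>h\<close> the kernel is bounded and continuous in \<open>\<theta>\<close>, so no cutoff is needed.
  The neighbourhood is a product: mixing measures weakly near the distribution with density \<open>f0\<close>, and
  scales \<open>\<phi>\<close> in \<open>{h<..<h * exp (\<eta> / 2)}\<close>. Each factor contributes \<open>exp (\<eta> / 2)\<close> to the ratio bound.
\<close>

lemma KL_ball_mixture_II:
  assumes \<nu>: "\<nu> > 0" and Q: "prior_on_measures UNIV Q" and \<mu>: "\<mu> \<in> prob_measures {0<..}"
    and supp: "full_support_II Q \<mu>"
    and f0: "is_density f0" and f0_pos: "\<And>x. 0 < f0 x"
    and log_moment: "integrable lborel (\<lambda>x. log_plus \<bar>x\<bar> * f0 x)"
    and h: "h > 0"
    and F_def: "\<And>x. F x = (\<integral>u. student_t_density \<nu> u * f0 (x - h * u) \<partial>lborel)"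
    and F_pos: "\<And>x. 0 < F x"
    and F_int: "integrable lborel (\<lambda>x. f0 x * ln (f0 x / F x))"
    and F_less: "(\<integral>x. f0 x * ln (f0 x / F x) \<partial>lborel) < \<epsilon>"
  shows "emeasure (mixture_prior_II (student_t_density \<nu>) Q \<mu>) {f. is_density f \<and> KL_div f0 f < ereal \<epsilon>} > 0"
proof -
  define b where "b = h * sqrt \<nu>"
  have b: "b > 0" using h \<nu> by (simp add: b_def)
  obtain \<eta> R where \<eta>: "\<eta> > 0" and ratio: "\<And>f. is_density f \<Longrightarrow>
      AE x in lborel. F x \<le> exp \<eta> * (if \<bar>x\<bar> \<le> R then 1 else (1 + \<bar>x\<bar> / b) powr (2 * (\<nu> + 1))) * f x
      \<Longrightarrow> KL_div f0 f < ereal \<epsilon>"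
    using KL_div_less_of_ratio_bound[OF f0 f0_pos F_pos F_int F_less log_moment b, of "2 * (\<nu> + 1)"] \<nu> by auto
  have f0_meas [measurable]: "f0 \<in> borel_measurable borel"
    using f0 borel_measurable_integrable by (force simp: is_density_def has_bochner_integral_iff)
  interpret \<mu>: prob_space \<mu> by (rule prob_measuresD[OF \<mu>])
  have id_\<mu> [measurable]: "(\<lambda>\<phi>. \<phi>) \<in> borel_measurable \<mu>"
    by (simp add: measurable_cong_sets[OF prob_measuresD(2)[OF \<mu>] refl] measurable_restrict_space1)
  define k where "k \<phi> x \<theta> = t_kernel \<nu> x \<theta> \<phi>" for \<phi> x \<theta>
  have mix: "mixture_density_II (student_t_density \<nu>) P \<phi> x = (\<integral>\<theta>. k \<phi> x \<theta> \<partial>P)" for P \<phi> x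
    by (simp add: mixture_density_II_def k_def t_kernel_def)
  have kernel: "density_kernel borel (k \<phi>)" if "\<phi> > 0" for \<phi>
    by standard (use \<nu> that in \<open>auto simp: k_def t_kernel_pos nn_integral_t_kernel\<close>)
  note mixture = density_kernel.mixture_density[OF kernel]
  have k_cont: "continuous_on UNIV (k \<phi> x)" if "\<phi> > 0" for \<phi> x
    unfolding k_def using \<nu> that by (intro continuous_intros) auto
  have k_bounded: "bounded (range (k \<phi> x))" if "\<phi> > 0" for \<phi> x
    unfolding bounded_iff using t_kernel_le[OF \<nu> that] t_kernel_pos[OF \<nu> that]
    by (intro exI[of _ "student_t_density \<nu> 0 / \<phi>"]) (auto simp: k_def less_imp_le)

  define P0 where "P0 = density lborel (\<lambda>\<theta>. ennreal (f0 \<theta>))"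
  have P0: "P0 \<in> prob_measures UNIV"
    unfolding prob_measures_def P0_def using prob_space_density[OF f0] by simp
  have k_P0: "(\<integral>\<theta>. k h x \<theta> \<partial>P0) = F x" for x
    unfolding P0_def k_def F_def by (rule integral_t_kernel_density[OF f0 h])
  have Harnack: "k h x \<theta> \<le> (1 + \<bar>x - y\<bar> / b) powr (\<nu> + 1) * k h y \<theta>" for x y \<theta>
    unfolding k_def b_def using h \<nu> by (intro t_kernel_Harnack) auto
  obtain U where U: "openin (weak_topology UNIV) U" "P0 \<in> U"
    and U_ratio: "\<And>P x. P \<in> U \<Longrightarrow>
      F x \<le> exp (\<eta> / 2) * (if \<bar>x\<bar> \<le> R then 1 else (1 + \<bar>x\<bar> / b) powr (2 * (\<nu> + 1))) * (\<integral>\<theta>. k h x \<theta> \<partial>P)"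
    using weak_nbhd_kernel_integral[OF P0 k_cont[OF h] k_bounded[OF h] Harnack _ b, of "\<eta> / 2" R] F_pos \<nu> \<eta>
    unfolding k_P0 by auto
  define V where "V = {h<..<h * exp (\<eta> / 2)}"
  have V_pos: "\<phi> > 0" if "\<phi> \<in> V" for \<phi> using that h by (auto simp: V_def)
  have V_open: "openin (top_of_set {0<..}) V"
    unfolding V_def using h by (intro openin_open_subtopology[THEN iffD2] conjI) auto
  have V_ratio: "(\<integral>\<theta>. k h x \<theta> \<partial>P) \<le> exp (\<eta> / 2) * (\<integral>\<theta>. k \<phi> x \<theta> \<partial>P)"
    if P: "P \<in> prob_measures UNIV" and \<phi>: "\<phi> \<in> V" for P \<phi> x
  proof -
    have "(\<integral>\<theta>. k h x \<theta> \<partial>P) \<le> (\<integral>\<theta>. exp (\<eta> / 2) * k \<phi> x \<theta> \<partial>P)"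
    proof (intro integral_mono integrable_mult_right integrable_bounded_continuous[OF P] k_cont k_bounded h V_pos[OF \<phi>])
      fix \<theta>
      have "k h x \<theta> \<le> \<phi> / h * k \<phi> x \<theta>"
        unfolding k_def using \<phi> by (intro t_kernel_scale \<nu> h) (auto simp: V_def)
      also have "\<dots> \<le> exp (\<eta> / 2) * k \<phi> x \<theta>"
        using \<phi> h t_kernel_pos[OF \<nu> V_pos[OF \<phi>]] unfolding k_def
        by (intro mult_right_mono) (auto simp: V_def field_simps less_imp_le)
      finally show "k h x \<theta> \<le> exp (\<eta> / 2) * k \<phi> x \<theta>" .
    qed
    then show ?thesis by simp
  qed

  have U_sets: "U \<in> sets Q" by (rule openin_sets_prior[OF Q U(1)])
  have V_sets: "V \<in> sets \<mu>"
    unfolding prob_measuresD[OF \<mu>] using V_pos by (auto simp: sets_restrict_space_iff V_def)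
  have U_pos: "0 < emeasure Q U"
    using supp P0 U unfolding full_support_II_def support_in_def by blast
  have V_pos_measure: "0 < emeasure \<mu> V"
  proof -
    have "h * exp (\<eta> / 4) \<in> V" using h \<eta> by (auto simp: V_def)
    moreover from this have "h * exp (\<eta> / 4) \<in> support_in (top_of_set {0<..}) \<mu>"
      using supp h unfolding full_support_II_def by simp
    ultimately show ?thesis using V_open unfolding support_in_def by blast
  qed

  show ?thesis
    unfolding mixture_prior_II_def
  proof (rule emeasure_law_KL_ball_pos[OF _ f0_meas])
    show "(\<lambda>(p, x). (case p of (P, \<phi>) \<Rightarrow> mixture_density_II (student_t_density \<nu>) P \<phi>) x)
      \<in> borel_measurable ((Q \<Otimes>\<^sub>M \<mu>) \<Otimes>\<^sub>M lborel)"
      unfolding mix[abs_def] split_beta'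
    proof (rule borel_measurable_integral_subprob_algebra[where N = borel])
      show "(\<lambda>p. fst (fst p)) \<in> (Q \<Otimes>\<^sub>M \<mu>) \<Otimes>\<^sub>M lborel \<rightarrow>\<^sub>M subprob_algebra borel"
        using measurable_prior_subprob_algebra[OF Q]
        by (auto intro!: measurable_compose[OF measurable_fst] simp: subprob_algebra_cong[of "restrict_space borel UNIV" borel])
      show "(\<lambda>(p, z). k (snd (fst p)) (snd p) z) \<in> borel_measurable (((Q \<Otimes>\<^sub>M \<mu>) \<Otimes>\<^sub>M lborel) \<Otimes>\<^sub>M borel)"
        unfolding k_def by measurable
    qed (use \<nu> in \<open>auto simp: k_def space_pair_measure prob_measuresD[OF \<mu>] intro!: less_imp_le[OF t_kernel_pos]\<close>)
    fix p assume "p \<in> space (Q \<Otimes>\<^sub>M \<mu>)"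
    then obtain P \<phi> where p: "p = (P, \<phi>)" "P \<in> prob_measures UNIV" "\<phi> > 0"
      by (auto simp: space_pair_measure space_prior[OF Q] prob_measuresD[OF \<mu>])
    show "is_density (case p of (P, \<phi>) \<Rightarrow> mixture_density_II (student_t_density \<nu>) P \<phi>)"
      using mixture(1)[OF p(3) prob_measuresD(1)[OF p(2)]] prob_measuresD(2)[OF p(2)] by (simp add: p(1) mix[abs_def])
    show "AE x in lborel. 0 < (case p of (P, \<phi>) \<Rightarrow> mixture_density_II (student_t_density \<nu>) P \<phi>) x"
      using mixture(3)[OF p(3) prob_measuresD(1)[OF p(2)]] prob_measuresD(2)[OF p(2)] by (simp add: p(1) mix)
  next
    show "U \<times> V \<in> sets (Q \<Otimes>\<^sub>M \<mu>)" using U_sets V_sets by (rule pair_measureI)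
    show "0 < emeasure (Q \<Otimes>\<^sub>M \<mu>) (U \<times> V)"
      using U_pos V_pos_measure by (simp add: \<mu>.emeasure_pair_measure_Times[OF U_sets V_sets] ennreal_zero_less_mult_iff)
    fix p assume "p \<in> U \<times> V"
    then obtain P \<phi> where p: "p = (P, \<phi>)" "P \<in> U" "\<phi> \<in> V" by auto
    have P: "P \<in> prob_measures UNIV" using p openin_subset[OF U(1)] by auto
    have "F x \<le> exp \<eta> * (if \<bar>x\<bar> \<le> R then 1 else (1 + \<bar>x\<bar> / b) powr (2 * (\<nu> + 1))) * (\<integral>\<theta>. k \<phi> x \<theta> \<partial>P)" for x
    proof -
      let ?c = "if \<bar>x\<bar> \<le> R then 1 else (1 + \<bar>x\<bar> / b) powr (2 * (\<nu> + 1))"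
      have "F x \<le> exp (\<eta> / 2) * ?c * (\<integral>\<theta>. k h x \<theta> \<partial>P)" by (rule U_ratio[OF p(2)])
      also have "\<dots> \<le> exp (\<eta> / 2) * ?c * (exp (\<eta> / 2) * (\<integral>\<theta>. k \<phi> x \<theta> \<partial>P))"
        by (intro mult_left_mono V_ratio[OF P p(3)]) auto
      also have "\<dots> = (exp (\<eta> / 2) * exp (\<eta> / 2)) * ?c * (\<integral>\<theta>. k \<phi> x \<theta> \<partial>P)" by (simp only: mult_ac)
      also have "exp (\<eta> / 2) * exp (\<eta> / 2) = exp \<eta>" by (simp add: exp_add[symmetric])
      finally show ?thesis .
    qed
    then show "KL_div f0 (case p of (P, \<phi>) \<Rightarrow> mixture_density_II (student_t_density \<nu>) P \<phi>) < ereal \<epsilon>"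
      using mixture(1)[OF V_pos[OF p(3)] prob_measuresD(1)[OF P]] prob_measuresD(2)[OF P]
      by (simp add: p(1) mix[abs_def], intro ratio AE_I2) auto
  qed
qed

theorem theorem8:
  fixes \<nu> :: real and f0 :: "real \<Rightarrow> real" and \<Pi>star :: "(real \<Rightarrow> real) measure"
  assumes "\<nu> > 0"
    and prior: "(\<exists>Q. prior_on_measures (UNIV \<times> {0<..}) Q \<and> full_support_I Q \<and>
             \<Pi>star = mixture_prior_I (student_t_density \<nu>) Q) \<or>
           (\<exists>Q \<mu>. prior_on_measures UNIV Q \<and> \<mu> \<in> prob_measures {0<..} \<and>
             full_support_II Q \<mu> \<and>
             \<Pi>star = mixture_prior_II (student_t_density \<nu>) Q \<mu>)"
    and "is_density f0" and "continuous_on UNIV f0"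
    and B4: "\<exists>M>0. \<forall>x. 0 < f0 x \<and> f0 x \<le> M"
    and B5: "integrable lborel (\<lambda>x. f0 x * ln (f0 x))"
    and B6: "\<exists>\<delta>>0. integrable lborel (\<lambda>x. f0 x * ln (f0 x / local_inf \<delta> f0 x))"
    and "integrable lborel (\<lambda>x. log_plus \<bar>x\<bar> * f0 x)"
  shows "in_KL_support f0 \<Pi>star"
  unfolding in_KL_support_def
proof (intro allI impI)
  fix \<epsilon> :: real assume \<epsilon>: "\<epsilon> > 0"
  obtain M where M: "\<And>x. 0 < f0 x" "\<And>x. f0 x \<le> M" using B4 by auto
  obtain \<delta> where \<delta>: "integrable lborel (\<lambda>x. f0 x * ln (f0 x / local_inf \<delta> f0 x))" "\<delta> > 0"
    using B6 by auto
  obtain h where h: "h > 0"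
    "\<And>x. 0 < (\<integral>u. student_t_density \<nu> u * f0 (x - h * u) \<partial>lborel)"
    "integrable lborel (\<lambda>x. f0 x * ln (f0 x / (\<integral>u. student_t_density \<nu> u * f0 (x - h * u) \<partial>lborel)))"
    "(\<integral>x. f0 x * ln (f0 x / (\<integral>u. student_t_density \<nu> u * f0 (x - h * u) \<partial>lborel)) \<partial>lborel) < \<epsilon>"
    by (rule KL_smoothing_small[OF \<open>is_density f0\<close> \<open>continuous_on UNIV f0\<close> M B5 \<delta>
          student_t_is_density[OF \<open>\<nu> > 0\<close>] student_t_density_pos[OF \<open>\<nu> > 0\<close>] \<epsilon>], rule that)
  from prior show "0 < emeasure \<Pi>star {f. is_density f \<and> KL_div f0 f < ereal \<epsilon>}"
  proof (elim disjE exE conjE)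
    fix Q assume "prior_on_measures (UNIV \<times> {0<..}) Q" "full_support_I Q"
      "\<Pi>star = mixture_prior_I (student_t_density \<nu>) Q"
    then show ?thesis
      using KL_ball_mixture_I[OF \<open>\<nu> > 0\<close> _ _ \<open>is_density f0\<close> M(1) assms(8) h(1) refl h(2-4)] by simp
  next
    fix Q \<mu> assume "prior_on_measures UNIV Q" "\<mu> \<in> prob_measures {0<..}" "full_support_II Q \<mu>"
      "\<Pi>star = mixture_prior_II (student_t_density \<nu>) Q \<mu>"
    then show ?thesis
      using KL_ball_mixture_II[OF \<open>\<nu> > 0\<close> _ _ _ \<open>is_density f0\<close> M(1) assms(8) h(1) refl h(2-4)] by simp
  qed
qed

end
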